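(* Let $\mu:G\times H\to K$ be a graph homomorphism, where $K$ is square-free and $G$ and $H$ are connected and non-bipartite. Then there are graph homomorphisms $\mu^*:G\times H\to K$, $\gamma:G\times H\to I$ and $\delta:I\to K$ such that $\mu^*=\delta\circ\gamma$ and $\mu^*$ is reachable from $\mu$ by recoloring, where $I$ is either $G$, $H$, or $C_n$ for some $n\in\mathbb{N}$.
   Context: All graphs are finite, simple, loopless; every graph has at least two vertices and no isolated vertices. $G\times H$ is the tensor product (vertices $V(G)\times V(H)$, $(g,h)(g',h')$ an edge iff $gg'\in E(G)$ and $hh'\in E(H)$). A graph is square-free if there are no four pairwise distinct vertices $v_1,\dots,v_4$ with $v_1v_2,v_2v_3,v_3v_4,v_4v_1$ edges. $C_n$ is the graph with vertex set $\{0,\dots,n-1\}$ and edges $\{i,i+1\bmod n\}$. A $K$-coloring of a graph is a homomorphism to $K$; $\mu^*$ is reachable from $\mu$ by recoloring if there is a sequence of $K$-colorings $\mu=\mu_0,\dots,\mu_m=\mu^*$ of $G\times H$ with consecutive ones differing on at most one vertex. *)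

theory Defs
  imports "Graph_Theory.Graph_Theory"
begin

text \<open>
  \<^const>\<open>pair_graph\<close> says: finite, symmetric and loopless arc relation on a finite
  vertex set, i.e. a finite simple graph, the edge $uv$ being the two arcs $(u,v)$ and $(v,u)$.
\<close>

definition proper_graph :: "'a pair_pre_digraph \<Rightarrow> bool" where
  "proper_graph G \<longleftrightarrow> pair_graph G \<and> 2 \<le> card (pverts G) \<and>
     (\<forall>v\<in>pverts G. \<exists>w\<in>pverts G. (v, w) \<in> parcs G)"

definition bipartite :: "'a pair_pre_digraph \<Rightarrow> bool" where
  "bipartite G \<longleftrightarrow> (\<exists>A B. pverts G = A \<union> B \<and> A \<inter> B = {} \<and>
     (\<forall>(u, v)\<in>parcs G. (u \<in> A \<and> v \<in> B) \<or> (u \<in> B \<and> v \<in> A)))"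

definition square_free :: "'a pair_pre_digraph \<Rightarrow> bool" where
  "square_free G \<longleftrightarrow> \<not> (\<exists>v1 v2 v3 v4. distinct [v1, v2, v3, v4] \<and>
     (v1, v2) \<in> parcs G \<and> (v2, v3) \<in> parcs G \<and> (v3, v4) \<in> parcs G \<and> (v4, v1) \<in> parcs G)"

definition tensor_product ::
  "'a pair_pre_digraph \<Rightarrow> 'b pair_pre_digraph \<Rightarrow> ('a \<times> 'b) pair_pre_digraph"
  where
  "tensor_product G H =
     \<lparr>pverts = pverts G \<times> pverts H,
      parcs = {((g, h), (g', h')) | g h g' h'. (g, g') \<in> parcs G \<and> (h, h') \<in> parcs H}\<rparr>"

definition cycle_graph :: "nat \<Rightarrow> nat pair_pre_digraph" where
  "cycle_graph n =
     \<lparr>pverts = {0..<n},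
      parcs = (\<Union>i\<in>{0..<n}. {(i, (i + 1) mod n), ((i + 1) mod n, i)})\<rparr>"

text \<open>
  Only the values of a homomorphism on the vertices of its source matter; values elsewhere
  are unconstrained.
\<close>

definition graph_hom :: "'a pair_pre_digraph \<Rightarrow> 'b pair_pre_digraph \<Rightarrow> ('a \<Rightarrow> 'b) \<Rightarrow> bool" where
  "graph_hom G K f \<longleftrightarrow> (\<forall>v\<in>pverts G. f v \<in> pverts K) \<and>
     (\<forall>(u, v)\<in>parcs G. (f u, f v) \<in> parcs K)"

definition recoloring_reachable ::
  "'a pair_pre_digraph \<Rightarrow> 'b pair_pre_digraph \<Rightarrow> ('a \<Rightarrow> 'b) \<Rightarrow> ('a \<Rightarrow> 'b) \<Rightarrow> bool"
  where
  "recoloring_reachable G K f f' \<longleftrightarrow> (\<exists>(m::nat) s. s 0 = f \<and> s m = f' \<and>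
     (\<forall>i\<le>m. graph_hom G K (s i)) \<and>
     (\<forall>i<m. card {v \<in> pverts G. s i v \<noteq> s (Suc i) v} \<le> 1))"

definition factors_through ::
  "'a pair_pre_digraph \<Rightarrow> 'i pair_pre_digraph \<Rightarrow> 'b pair_pre_digraph \<Rightarrow> ('a \<Rightarrow> 'b) \<Rightarrow> bool"
  where
  "factors_through G I K f \<longleftrightarrow> (\<exists>\<gamma> \<delta>. graph_hom G I \<gamma> \<and> graph_hom I K \<delta> \<and>
     (\<forall>v\<in>pverts G. f v = (\<delta> \<circ> \<gamma>) v))"

lemma proper_graph_tensor_product:
  assumes "proper_graph G" "proper_graph H"
  shows "proper_graph (tensor_product G H)"
proof -
  interpret G: pair_graph G using assms by (simp add: proper_graph_def)
  interpret H: pair_graph H using assms by (simp add: proper_graph_def)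
  have sub: "parcs (tensor_product G H) \<subseteq> (pverts G \<times> pverts H) \<times> (pverts G \<times> pverts H)"
    by (auto simp: tensor_product_def dest: G.wellformed' H.wellformed')
  have "pair_graph (tensor_product G H)"
  proof
    show "finite (parcs (tensor_product G H))"
      by (rule finite_subset[OF sub]) (simp add: G.pair_finite_verts H.pair_finite_verts)
    have "sym (parcs G)" "sym (parcs H)"
      using G.pair_sym_arcs H.pair_sym_arcs by (simp_all add: symmetric_def)
    then show "symmetric (tensor_product G H)"
      by (auto simp: symmetric_def tensor_product_def sym_def)
  qed (auto simp: tensor_product_def G.pair_finite_verts H.pair_finite_verts
            dest: G.wellformed' H.wellformed' G.pair_no_loops)
  moreover have "2 \<le> card (pverts (tensor_product G H))"
  proof -
    have "2 \<le> card (pverts G)" "2 \<le> card (pverts H)"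
      using assms by (simp_all add: proper_graph_def)
    then have "2 * 1 \<le> card (pverts G) * card (pverts H)" by (intro mult_le_mono) auto
    then show ?thesis by (simp add: tensor_product_def card_cartesian_product)
  qed
  ultimately show ?thesis
    using assms by (fastforce simp: proper_graph_def tensor_product_def)
qed

lemma proper_graph_cycle_graph: "proper_graph (cycle_graph n) \<longleftrightarrow> 2 \<le> n"
proof
  assume "proper_graph (cycle_graph n)"
  then show "2 \<le> n" by (simp add: proper_graph_def cycle_graph_def)
next
  assume n: "2 \<le> n"
  have ne: "i \<noteq> Suc i mod n" if "i < n" for i
    using n that by (cases "Suc i = n") auto
  have "pair_graph (cycle_graph n)"
  proof
    show "symmetric (cycle_graph n)"
      by (auto simp: symmetric_def cycle_graph_def sym_def)
  qed (use n ne in \<open>auto simp: cycle_graph_def dest: sym\<close>)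
  then show "proper_graph (cycle_graph n)"
    using n by (fastforce simp: proper_graph_def cycle_graph_def)
qed

end

theory Submission
  imports Defs "HOL-Library.Stream"
begin

text \<open>
  The walks in \<open>G \<times> H\<close> act on the universal cover of \<open>K\<close>, a tree. Since \<open>K\<close> is square-free,
  closed walks of length 4 act trivially, so the closed walks of even length in \<open>G\<close> act by deck
  transformations that commute with those of the closed walks of even length in \<open>H\<close>.

  If those of \<open>G\<close> act trivially, each layer \<open>G \<times> {h}\<close> lifts to the tree. As long as some layer
  is not constant, one of the layers of maximal diameter has an end point all of whose
  neighbours lie further inside; recoloring moves it inwards. When all layers are constant, the
  coloring factors through \<open>H\<close>. The case that \<open>H\<close> acts trivially is symmetric.

  Otherwise let \<open>a\<close> from \<open>G\<close> and \<open>b\<close> from \<open>H\<close> be nontrivial. Then \<open>a\<close> is a translation towards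
  an end of the tree. This end is fixed by everything commuting with \<open>a\<close>, in particular by \<open>b\<close>;
  hence also by everything commuting with \<open>b\<close>, and finally by every closed walk in \<open>G \<times> H\<close>,
  whose square is a product of the two kinds. So each vertex of \<open>G \<times> H\<close> sees the end as an
  infinite reduced walk in \<open>K\<close>, and for adjacent vertices one of these is the tail of the other.
  As \<open>G \<times> H\<close> has odd closed walks, they are all eventually periodic, and pushing the vertices
  towards the end makes them periodic, which is a factorization through a cycle.
\<close>

section \<open>Walks\<close>

fun walk :: "('a \<times> 'a) set \<Rightarrow> 'a \<Rightarrow> 'a list \<Rightarrow> 'a \<Rightarrow> bool" where
  "walk E x [] y \<longleftrightarrow> x = y"
| "walk E x (u # us) y \<longleftrightarrow> (x, u) \<in> E \<and> walk E u us y"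

lemma walk_append: "walk E x (us @ vs) z \<longleftrightarrow> (\<exists>y. walk E x us y \<and> walk E y vs z)"
  by (induction us arbitrary: x) auto

lemma walk_appendI: "walk E x us y \<Longrightarrow> walk E y vs z \<Longrightarrow> walk E x (us @ vs) z"
  by (auto simp: walk_append)

lemma walk_last: "walk E x us y \<Longrightarrow> last (x # us) = y"
  by (induction us arbitrary: x) auto

lemma walk_in_vertices: "walk E x us y \<Longrightarrow> E \<subseteq> V \<times> V \<Longrightarrow> x \<in> V \<Longrightarrow> y \<in> V"
  by (induction us arbitrary: x) auto

lemma walk_map:
  assumes "walk R v us w" and "\<And>u v. (u, v) \<in> R \<Longrightarrow> (f u, f v) \<in> E"
  shows "walk E (f v) (map f us) (f w)"
  using assms(1) by (induction us arbitrary: v) (auto intro: assms(2))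

definition rev_walk :: "'a \<Rightarrow> 'a list \<Rightarrow> 'a list" where
  "rev_walk x us = rev (butlast (x # us))"

lemma rev_walk_simps [simp]:
  "rev_walk x [] = []"
  "rev_walk x (u # us) = rev_walk u us @ [x]"
  by (simp_all add: rev_walk_def)

lemma length_rev_walk [simp]: "length (rev_walk x us) = length us"
  by (simp add: rev_walk_def)

lemma rev_walk_rev_walk: "rev_walk (last (x # us)) (rev_walk x us) = us"
  by (cases us rule: rev_cases) (simp_all add: rev_walk_def butlast_append)

lemma walk_rev_walk: "sym E \<Longrightarrow> walk E x us y \<Longrightarrow> walk E y (rev_walk x us) x"
  by (induction us arbitrary: x) (auto simp: walk_append dest: symD)

lemma map_rev_walk: "map f (rev_walk x us) = rev_walk (f x) (map f us)"
  by (induction us arbitrary: x) auto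

lemma rev_walk_zip:
  "length us = length vs \<Longrightarrow> rev_walk (x, y) (zip us vs) = zip (rev_walk x us) (rev_walk y vs)"
  by (induction us vs arbitrary: x y rule: list_induct2) auto

fun alternate :: "nat \<Rightarrow> 'a \<Rightarrow> 'a \<Rightarrow> 'a list" where
  "alternate 0 a b = []"
| "alternate (Suc n) a b = a # alternate n b a"

lemma length_alternate [simp]: "length (alternate n a b) = n"
  by (induction n arbitrary: a b) auto

lemma alternate_append:
  "alternate (m + n) a b = alternate m a b @ (if even m then alternate n a b else alternate n b a)"
  by (induction m arbitrary: a b) auto

lemma alternate_snoc: "alternate n a b @ [if even n then a else b] = a # alternate n b a"
  using alternate_append[of n 1 a b] by simp

lemma walk_alternate:
  assumes "sym E" "(b, a) \<in> E"
  shows "walk E b (alternate n a b) (if even n then b else a)"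
  using assms(2)
proof (induction n arbitrary: a b)
  case (Suc n)
  then show ?case using symD[OF assms(1), of b a] by auto
qed simp

lemma rev_walk_alternate:
  "rev_walk b (alternate n a b) = (if even n then alternate n a b else alternate n b a)"
proof (induction n arbitrary: a b)
  case (Suc n)
  then show ?case
    using alternate_snoc[of n a b] alternate_snoc[of n b a] by (cases "even n") simp_all
qed simp

lemma zip_alternate: "zip (alternate n a b) (alternate n c d) = alternate n (a, c) (b, d)"
  by (induction n arbitrary: a b c d) auto

lemma map_alternate: "map f (alternate n a b) = alternate n (f a) (f b)"
  by (induction n arbitrary: a b) auto

lemma walk_pad:
  assumes "sym E" "walk E x us y" "(y, z) \<in> E" "length us \<le> n" "even n = even (length us)"
  shows "\<exists>us'. length us' = n \<and> walk E x us' y"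
proof -
  have "even (n - length us)"
    using assms(4,5) by auto
  then have "walk E x (us @ alternate (n - length us) z y) y"
    using walk_alternate[OF assms(1,3), of "n - length us"] assms(2) by (auto simp: walk_append)
  then show ?thesis
    using assms(4) by (intro exI[of _ "us @ alternate (n - length us) z y"]) auto
qed

section \<open>Graphs and their tensor products\<close>

lemma
  assumes "proper_graph G"
  shows proper_graph_finite: "finite (pverts G)"
    and proper_graph_sym: "sym (parcs G)"
    and proper_graph_subset: "parcs G \<subseteq> pverts G \<times> pverts G"
    and proper_graph_irrefl: "(x, x) \<notin> parcs G"
    and proper_graph_neighbour: "v \<in> pverts G \<Longrightarrow> \<exists>w. (v, w) \<in> parcs G"
    and proper_graph_nonempty: "pverts G \<noteq> {}"
proof -
  interpret pair_graph G using assms by (simp add: proper_graph_def)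
  show "finite (pverts G)" by (rule pair_finite_verts)
  show "sym (parcs G)" using pair_sym_arcs by (simp add: symmetric_def)
  show "parcs G \<subseteq> pverts G \<times> pverts G" by (auto dest: wellformed')
  show "(x, x) \<notin> parcs G" using pair_no_loops by force
  show "v \<in> pverts G \<Longrightarrow> \<exists>w. (v, w) \<in> parcs G" using assms by (auto simp: proper_graph_def)
  show "pverts G \<noteq> {}" using assms by (auto simp: proper_graph_def)
qed

lemma square_freeD:
  assumes "square_free G" "proper_graph G"
    and "(a, b) \<in> parcs G" "(b, c) \<in> parcs G" "(c, d) \<in> parcs G" "(d, a) \<in> parcs G"
  shows "a = c \<or> b = d"
proof (rule ccontr)
  assume "\<not> ?thesis"
  moreover have "a \<noteq> b" "b \<noteq> c" "c \<noteq> d" "d \<noteq> a"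
    using assms(3-6) proper_graph_irrefl[OF assms(2)] by auto
  ultimately have "distinct [a, b, c, d]"
    by auto
  with assms show False
    unfolding square_free_def by blast
qed

lemma graph_hom_arcD: "graph_hom G K f \<Longrightarrow> (u, v) \<in> parcs G \<Longrightarrow> (f u, f v) \<in> parcs K"
  by (auto simp: graph_hom_def)

lemma graph_hom_if_arcs:
  assumes "proper_graph G" "proper_graph K"
    and "\<And>u v. (u, v) \<in> parcs G \<Longrightarrow> (f u, f v) \<in> parcs K"
  shows "graph_hom G K f"
  using assms(3) proper_graph_neighbour[OF assms(1)] proper_graph_subset[OF assms(2)]
  unfolding graph_hom_def by fast

lemma walk_graph_hom:
  "graph_hom G K f \<Longrightarrow> walk (parcs G) u us v \<Longrightarrow> walk (parcs K) (f u) (map f us) (f v)"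
  by (rule walk_map[OF _ graph_hom_arcD])

lemma graph_hom_comp: "graph_hom G I g \<Longrightarrow> graph_hom I K f \<Longrightarrow> graph_hom G K (f \<circ> g)"
  by (fastforce simp: graph_hom_def)

lemma factors_through_comp:
  assumes "factors_through G' I K f" "graph_hom G G' g"
  shows "factors_through G I K (f \<circ> g)"
proof -
  obtain \<gamma> \<delta> where "graph_hom G' I \<gamma>" "graph_hom I K \<delta>" "\<forall>v\<in>pverts G'. f v = (\<delta> \<circ> \<gamma>) v"
    using assms(1) unfolding factors_through_def by blast
  then show ?thesis
    using assms(2) graph_hom_comp[OF assms(2), of I \<gamma>] unfolding factors_through_def
    by (intro exI[of _ "\<gamma> \<circ> g"] exI[of _ \<delta>]) (auto simp: graph_hom_def)
qed

definition parity_connected :: "'a pair_pre_digraph \<Rightarrow> bool" where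
  "parity_connected G \<longleftrightarrow>
     (\<forall>u\<in>pverts G. \<forall>v\<in>pverts G. \<forall>c. \<exists>us. even (length us) = c \<and> walk (parcs G) u us v)"

lemma parity_connectedE:
  assumes "parity_connected G" "u \<in> pverts G" "v \<in> pverts G"
  obtains us where "even (length us) = c" "walk (parcs G) u us v"
  using assms unfolding parity_connected_def by blast

lemma connected_walk:
  assumes "proper_graph G" "Digraph_Component.connected (with_proj G)" "u \<in> pverts G" "v \<in> pverts G"
  shows "\<exists>us. walk (parcs G) u us v"
proof -
  have "parcs (mk_symmetric (with_proj G)) = parcs G"
    using proper_graph_sym[OF assms(1)] by (auto simp: parcs_mk_symmetric sym_def)
  then have "(u, v) \<in> rtrancl_on (pverts G) (parcs G)"
    using assms(2-4)
    by (auto simp: Digraph_Component.connected_def strongly_connected_def reachable_def)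
  then have "(u, v) \<in> (parcs G)\<^sup>*"
    by (rule rtrancl_on_rtranclI)
  then show ?thesis
  proof (induction rule: converse_rtrancl_induct)
    case base
    show ?case by (intro exI[of _ "[]"]) simp
  next
    case (step y z)
    then obtain us where "walk (parcs G) z us v" by blast
    with step show ?case by (intro exI[of _ "z # us"]) simp
  qed
qed

lemma nonbipartite_odd_closed_walk:
  assumes G: "proper_graph G" "Digraph_Component.connected (with_proj G)" "\<not> bipartite G"
    and u: "u \<in> pverts G"
  shows "\<exists>us. odd (length us) \<and> walk (parcs G) u us u"
proof -
  define S where
    "S c = {y \<in> pverts G. \<exists>us. even (length us) = c \<and> walk (parcs G) u us y}" for c
  have cover: "pverts G = S True \<union> S False"
    using connected_walk[OF G(1,2) u] by (auto simp: S_def)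
  have flip: "y \<in> S (\<not> c)" if x: "x \<in> S c" and xy: "(x, y) \<in> parcs G" for x y c
  proof -
    obtain us where "even (length us) = c" "walk (parcs G) u us x"
      using x by (auto simp: S_def)
    then have "even (length (us @ [y])) = (\<not> c)" "walk (parcs G) u (us @ [y]) y"
      using xy by (auto simp: walk_append)
    then show ?thesis
      using xy proper_graph_subset[OF G(1)] unfolding S_def by blast
  qed
  have "S True \<inter> S False \<noteq> {}"
  proof
    assume "S True \<inter> S False = {}"
    moreover have "(x \<in> S True \<and> y \<in> S False) \<or> (x \<in> S False \<and> y \<in> S True)"
      if "(x, y) \<in> parcs G" for x y
      using flip[of x True y] flip[of x False y] that cover proper_graph_subset[OF G(1)] by auto
    ultimately have "bipartite G"
      using cover unfolding bipartite_def by blast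
    with G(3) show False by simp
  qed
  then obtain z us vs where "even (length us)" "walk (parcs G) u us z"
      "odd (length vs)" "walk (parcs G) u vs z"
    by (auto simp: S_def)
  then have "odd (length (us @ rev_walk u vs))" "walk (parcs G) u (us @ rev_walk u vs) u"
    using walk_rev_walk[OF proper_graph_sym[OF G(1)]] by (auto simp: walk_append)
  then show ?thesis by blast
qed

lemma parity_connected_if_nonbipartite:
  assumes "proper_graph G" "Digraph_Component.connected (with_proj G)" "\<not> bipartite G"
  shows "parity_connected G"
  unfolding parity_connected_def
proof (intro ballI allI)
  fix u v c assume u: "u \<in> pverts G" and v: "v \<in> pverts G"
  obtain us where us: "walk (parcs G) u us v"
    using connected_walk[OF assms(1,2) u v] by blast
  obtain ws where ws: "odd (length ws)" "walk (parcs G) u ws u"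
    using nonbipartite_odd_closed_walk[OF assms u] by blast
  show "\<exists>us. even (length us) = c \<and> walk (parcs G) u us v"
  proof (cases "even (length us) = c")
    case False
    then have "even (length (ws @ us)) = c" "walk (parcs G) u (ws @ us) v"
      using us ws by (auto simp: walk_append)
    then show ?thesis by blast
  qed (use us in blast)
qed

lemma parity_connected_equal_length_walks:
  assumes "proper_graph G" "parity_connected G" "u \<in> pverts G"
  shows "\<exists>n. \<forall>v\<in>pverts G. \<exists>us. length us = n \<and> walk (parcs G) u us v"
proof -
  have "\<exists>us. even (length us) \<and> walk (parcs G) u us v" if "v \<in> pverts G" for v
    using parity_connectedE[OF assms(2,3) that, of True] by auto
  then obtain us where us: "even (length (us v))" "walk (parcs G) u (us v) v"
    if "v \<in> pverts G" for v
    by metis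
  let ?n = "\<Sum>v\<in>pverts G. length (us v)"
  have "\<exists>vs. length vs = ?n \<and> walk (parcs G) u vs v" if v: "v \<in> pverts G" for v
  proof -
    obtain w where w: "(v, w) \<in> parcs G"
      using proper_graph_neighbour[OF assms(1) v] by blast
    have "length (us v) \<le> ?n"
      using proper_graph_finite[OF assms(1)] v by (intro member_le_sum) auto
    moreover have "even ?n"
      using us(1) by (intro dvd_sum) auto
    ultimately show ?thesis
      using walk_pad[OF proper_graph_sym[OF assms(1)] us(2)[OF v] w] us(1)[OF v] by blast
  qed
  then show ?thesis by blast
qed

lemma pverts_tensor_product [simp]: "pverts (tensor_product G H) = pverts G \<times> pverts H"
  by (simp add: tensor_product_def)

lemma arc_tensor_product_iff [simp]:
  "((g, h), (g', h')) \<in> parcs (tensor_product G H) \<longleftrightarrow> (g, g') \<in> parcs G \<and> (h, h') \<in> parcs H"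
  by (simp add: tensor_product_def)

lemma graph_hom_snd: "graph_hom (tensor_product G H) H snd"
  by (auto simp: graph_hom_def)

lemma factors_through_snd:
  assumes "proper_graph G" "proper_graph H" "proper_graph K" "graph_hom (tensor_product G H) K f"
    and const: "\<And>g w h. g \<in> pverts G \<Longrightarrow> w \<in> pverts G \<Longrightarrow> h \<in> pverts H \<Longrightarrow> f (g, h) = f (w, h)"
  shows "factors_through (tensor_product G H) H K f"
proof -
  obtain g g' where g: "(g, g') \<in> parcs G"
    using proper_graph_nonempty[OF assms(1)] proper_graph_neighbour[OF assms(1)] by blast
  then have V: "g \<in> pverts G" "g' \<in> pverts G"
    using proper_graph_subset[OF assms(1)] by auto
  have "(f (g, h), f (g, h')) \<in> parcs K" if "(h, h') \<in> parcs H" for h h'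
  proof -
    have "(f (g, h), f (g', h')) \<in> parcs K"
      using graph_hom_arcD[OF assms(4), of "(g, h)" "(g', h')"] g that by simp
    then show ?thesis
      using const[OF V, of h'] that proper_graph_subset[OF assms(2)] by auto
  qed
  then have "graph_hom H K (\<lambda>h. f (g, h))"
    using assms(2,3) by (intro graph_hom_if_arcs)
  moreover have "\<forall>v\<in>pverts (tensor_product G H). f v = ((\<lambda>h. f (g, h)) \<circ> snd) v"
    using const[OF _ V(1)] by auto
  ultimately show ?thesis
    using graph_hom_snd unfolding factors_through_def by blast
qed

lemma graph_hom_swap: "graph_hom (tensor_product G H) (tensor_product H G) prod.swap"
  by (auto simp: graph_hom_def)

lemma zip_eq_map_swap_zip: "zip us vs = map prod.swap (zip vs us)"
  by (subst zip_commute) (simp add: prod.swap_def case_prod_beta)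

lemma walk_zip_iff:
  "length us = length vs \<Longrightarrow>
   walk (parcs (tensor_product G H)) (g, h) (zip us vs) (g', h') \<longleftrightarrow>
     walk (parcs G) g us g' \<and> walk (parcs H) h vs h'"
  by (induction us vs arbitrary: g h rule: list_induct2) auto

lemma walk_tensor_productE:
  assumes "walk (parcs (tensor_product G H)) (g, h) W (g', h')"
  obtains us vs where "W = zip us vs" "length us = length vs"
    "walk (parcs G) g us g'" "walk (parcs H) h vs h'"
proof -
  have "W = zip (map fst W) (map snd W)"
    by (simp add: zip_map_fst_snd)
  then show thesis
    using assms that[of "map fst W" "map snd W"] walk_zip_iff[of "map fst W" "map snd W"] by simp
qed

lemma parity_connected_tensor_product:
  assumes "proper_graph G" "parity_connected G" "proper_graph H" "parity_connected H"
  shows "parity_connected (tensor_product G H)"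
  unfolding parity_connected_def
proof (intro ballI allI)
  fix v w c assume "v \<in> pverts (tensor_product G H)" "w \<in> pverts (tensor_product G H)"
  then obtain g h g' h' where v: "v = (g, h)" "w = (g', h')"
    and V: "g \<in> pverts G" "h \<in> pverts H" "g' \<in> pverts G" "h' \<in> pverts H"
    by auto
  obtain us where us: "even (length us) = c" "walk (parcs G) g us g'"
    using parity_connectedE[OF assms(2) V(1,3)] .
  obtain vs where vs: "even (length vs) = c" "walk (parcs H) h vs h'"
    using parity_connectedE[OF assms(4) V(2,4)] .
  define n where "n = max (length us) (length vs)"
  have n: "even n = c" "length us \<le> n" "length vs \<le> n"
    using us vs by (auto simp: n_def max_def)
  obtain us' where us': "length us' = n" "walk (parcs G) g us' g'"
    using walk_pad[OF proper_graph_sym[OF assms(1)] us(2)] proper_graph_neighbour[OF assms(1) V(3)]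
      us(1) n by blast
  obtain vs' where vs': "length vs' = n" "walk (parcs H) h vs' h'"
    using walk_pad[OF proper_graph_sym[OF assms(3)] vs(2)] proper_graph_neighbour[OF assms(3) V(4)]
      vs(1) n by blast
  show "\<exists>W. even (length W) = c \<and> walk (parcs (tensor_product G H)) v W w"
    using us' vs' n v by (intro exI[of _ "zip us' vs'"]) (simp add: walk_zip_iff)
qed

section \<open>Reduced walks\<close>

text \<open>
  The vertices of the universal cover of a graph, seen from a vertex \<open>x\<close>, are the reduced walks
  starting in \<open>x\<close>. \<open>lstep\<close> moves the point of view to a neighbour of \<open>x\<close>, while \<open>rstep\<close> moves
  the vertex itself. These operations commute, so a closed walk acts by a deck transformation.
\<close>

fun lstep :: "'c \<Rightarrow> 'c list \<Rightarrow> 'c list" where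
  "lstep w (x # y # p) = (if w = y then y # p else w # x # y # p)"
| "lstep w p = w # p"

definition rstep :: "'c list \<Rightarrow> 'c \<Rightarrow> 'c list" where
  "rstep p w = rev (lstep w (rev p))"

abbreviation transport :: "'c list \<Rightarrow> 'c list \<Rightarrow> 'c list" where
  "transport \<equiv> fold lstep"

abbreviation prolong :: "'c list \<Rightarrow> 'c list \<Rightarrow> 'c list" where
  "prolong \<equiv> foldl rstep"

fun reduced :: "('c \<times> 'c) set \<Rightarrow> 'c list \<Rightarrow> bool" where
  "reduced E [] \<longleftrightarrow> False"
| "reduced E [x] \<longleftrightarrow> True"
| "reduced E (x # y # p) \<longleftrightarrow> (x, y) \<in> E \<and> (p = [] \<or> x \<noteq> hd p) \<and> reduced E (y # p)"

lemma rstep_simps [simp]: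
  "rstep [] w = [w]"
  "rstep [x] w = [x, w]"
  "rstep (p @ [x, y]) w = (if w = x then p @ [x] else p @ [x, y, w])"
  by (simp_all add: rstep_def)

lemma lstep_not_Nil [simp]: "lstep w p \<noteq> []"
  by (induction w p rule: lstep.induct) auto

lemma rstep_not_Nil [simp]: "rstep p w \<noteq> []"
  by (simp add: rstep_def)

lemma hd_lstep [simp]: "hd (lstep w p) = w"
  by (induction w p rule: lstep.induct) auto

lemma last_rstep [simp]: "last (rstep p w) = w"
  by (simp add: rstep_def last_rev)

lemma last_lstep: "p \<noteq> [] \<Longrightarrow> last (lstep w p) = last p"
  by (induction w p rule: lstep.induct) auto

lemma hd_rstep: "p \<noteq> [] \<Longrightarrow> hd (rstep p w) = hd p"
  by (simp add: rstep_def hd_rev last_rev last_lstep)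

lemma lstep_cases: "lstep w p = w # p \<or> lstep w p = tl p"
  by (induction w p rule: lstep.induct) auto

lemma rstep_cases: "rstep p w = p @ [w] \<or> rstep p w = butlast p"
  using lstep_cases[of w "rev p"] by (auto simp: rstep_def butlast_rev[of "rev p", simplified])

lemma length_lstep_le: "length (lstep w p) \<le> Suc (length p)"
  using lstep_cases[of w p] by auto

lemma length_le_lstep: "length p \<le> Suc (length (lstep w p))"
  using lstep_cases[of w p] by auto

lemma even_length_lstep: "even (length (lstep w p)) \<longleftrightarrow> odd (length p)"
  by (induction w p rule: lstep.induct) auto

lemma rstep_lstep: "rstep (lstep w p) k = lstep w (rstep p k)"
proof -
  consider "p = [] \<or> (\<exists>x. p = [x])" | x y where "p = [x, y]" | x y z where "p = [x, y, z]"
    | x y q z t where "p = x # y # q @ [z, t]"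
  proof (cases p rule: remdups_adj.cases)
    case (3 x y r)
    then show thesis
      using that(2-4) by (cases r rule: rev_cases; cases "butlast r" rule: rev_cases) auto
  qed (use that in auto)
  then show ?thesis
  proof cases
    case 1
    then show ?thesis
      using rstep_simps(3)[of "[]" w _ k] by auto
  next
    case (2 x y)
    then show ?thesis
      using rstep_simps(3)[of "[]" x y k] rstep_simps(3)[of "[w]" x y k] by auto
  next
    case (3 x y z)
    then show ?thesis
      using rstep_simps(3)[of "[]" y z k] rstep_simps(3)[of "[x]" y z k]
        rstep_simps(3)[of "[w, x]" y z k]
      by auto
  next
    case (4 x y q z t)
    then show ?thesis
      using rstep_simps(3)[of "x # y # q" z t k] rstep_simps(3)[of "y # q" z t k]
        rstep_simps(3)[of "w # x # y # q" z t k]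
      by auto
  qed
qed

lemma transport_prolong: "transport ws (prolong p ks) = prolong (transport ws p) ks"
proof -
  have "lstep w (prolong p ks) = prolong (lstep w p) ks" for w p
    by (induction ks arbitrary: p) (auto simp: rstep_lstep)
  then show ?thesis
    by (induction ws arbitrary: p) auto
qed

lemma rev_prolong: "rev (prolong p ks) = transport ks (rev p)"
  by (induction ks arbitrary: p) (auto simp: rstep_def)

lemma transport_not_Nil [simp]: "p \<noteq> [] \<Longrightarrow> transport ws p \<noteq> []"
  by (induction ws arbitrary: p) auto

lemma last_transport: "p \<noteq> [] \<Longrightarrow> last (transport ws p) = last p"
  by (induction ws arbitrary: p) (auto simp: last_lstep)

lemma hd_transport: "p \<noteq> [] \<Longrightarrow> walk E (hd p) ws y \<Longrightarrow> hd (transport ws p) = y"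
  by (induction ws arbitrary: p) auto

lemma even_length_transport:
  "even (length (transport ws p)) \<longleftrightarrow> (even (length p) \<longleftrightarrow> even (length ws))"
  by (induction ws arbitrary: p) (auto simp: even_length_lstep)

lemma length_le_transport: "length p \<le> length (transport ws p) + length ws"
proof (induction ws arbitrary: p)
  case (Cons w ws)
  show ?case using Cons[of "lstep w p"] length_le_lstep[of p w] by simp
qed simp

lemma take_prolong: "n + length ks \<le> length p \<Longrightarrow> take n (prolong p ks) = take n p"
proof (induction ks arbitrary: p)
  case (Cons k ks)
  then have "n + length ks \<le> length (rstep p k)" "take n (rstep p k) = take n p"
    using rstep_cases[of p k] by (auto simp: take_butlast)
  then show ?case
    using Cons.IH[of "rstep p k"] by simp
qed simp

lemma reduced_not_Nil [dest]: "reduced E p \<Longrightarrow> p \<noteq> []"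
  by auto

lemma reduced_append_Cons_iff:
  "reduced E (p @ y # q) \<longleftrightarrow>
     reduced E (p @ [y]) \<and> reduced E (y # q) \<and> (p = [] \<or> q = [] \<or> last p \<noteq> hd q)"
proof (induction p)
  case (Cons x p)
  then show ?case
    by (cases p) auto
qed simp

lemma reduced_appendD: "reduced E (p @ q) \<Longrightarrow> p \<noteq> [] \<Longrightarrow> reduced E p"
  by (cases p rule: rev_cases) (auto simp: reduced_append_Cons_iff[of E _ _ q])

lemma reduced_take: "reduced E p \<Longrightarrow> 0 < n \<Longrightarrow> reduced E (take n p)"
  by (rule reduced_appendD[of E _ "drop n p"]) auto

lemma rstep_eq_append: "reduced E (p @ [w]) \<Longrightarrow> p \<noteq> [] \<Longrightarrow> rstep p w = p @ [w]"
proof (cases p rule: rev_cases)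
  case (snoc q y)
  assume "reduced E (p @ [w])"
  then show ?thesis
    using snoc reduced_append_Cons_iff[of E q y "[w]"] by (cases q rule: rev_cases) auto
qed simp

lemma prolong_eq_append: "reduced E (p @ q) \<Longrightarrow> p \<noteq> [] \<Longrightarrow> prolong p q = p @ q"
proof (induction q arbitrary: p)
  case (Cons w q)
  then have "rstep p w = p @ [w]"
    using rstep_eq_append[of E p w] reduced_appendD[of E "p @ [w]" q] by simp
  then show ?case
    using Cons.IH[of "p @ [w]"] Cons.prems by simp
qed simp

lemma prolong_hd_tl: "reduced E p \<Longrightarrow> prolong [hd p] (tl p) = p"
  using prolong_eq_append[of E "[hd p]" "tl p"] by (cases p) auto

lemma prolong_tl_rev: "p \<noteq> [] \<Longrightarrow> prolong p (tl (rev p)) = [hd p]"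
proof (induction p rule: rev_induct)
  case (snoc z p)
  then show ?case
    by (cases p rule: rev_cases) (auto simp: hd_append)
qed simp

lemma prolong_from_to:
  assumes "p \<noteq> []" "reduced E q" "hd p = hd q"
  shows "prolong p (tl (rev p) @ tl q) = q"
  using assms by (simp add: prolong_tl_rev prolong_hd_tl)

lemma transport_tl: "p \<noteq> [] \<Longrightarrow> transport (tl p) p = [last p]"
  using rev_prolong[of "rev p" "tl p"] prolong_tl_rev[of "rev p"] by (simp add: hd_rev)

lemma transport_from_hd:
  "reduced E p \<Longrightarrow> transport ws p = prolong (transport ws [hd p]) (tl p)"
  using transport_prolong[of ws "[hd p]" "tl p"] by (simp add: prolong_hd_tl)

lemma transport_fixes_hd: "p \<noteq> [] \<Longrightarrow> transport ws p = p \<Longrightarrow> transport ws [hd p] = [hd p]"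
  using transport_prolong[of ws p "tl (rev p)"] by (simp add: prolong_tl_rev)

lemma transport_fixes_if_fixes_hd: "transport ws [hd p] = [hd p] \<Longrightarrow> reduced E p \<Longrightarrow> transport ws p = p"
  using transport_from_hd[of E p ws] by (simp add: prolong_hd_tl)

lemma walk_tl_reduced: "reduced E p \<Longrightarrow> walk E (hd p) (tl p) (last p)"
  by (induction p rule: induct_list012) auto

locale loopless_graph =
  fixes E :: "('c \<times> 'c) set"
  assumes sym_E: "sym E" and irrefl_E: "(x, x) \<notin> E"
begin

lemma reduced_rev: "reduced E (rev p) \<longleftrightarrow> reduced E p"
proof (induction p rule: induct_list012)
  case (3 x y p)
  then show ?case
    using reduced_append_Cons_iff[of E "rev p" y "[x]"] symD[OF sym_E, of x y]
      symD[OF sym_E, of y x]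
    by (auto simp: last_rev)
qed simp_all

lemma reduced_lstep: "reduced E p \<Longrightarrow> (hd p, w) \<in> E \<Longrightarrow> reduced E (lstep w p)"
  using symD[OF sym_E, of "hd p" w] by (induction w p rule: lstep.induct) auto

lemma reduced_rstep: "reduced E p \<Longrightarrow> (last p, w) \<in> E \<Longrightarrow> reduced E (rstep p w)"
  unfolding rstep_def reduced_rev by (rule reduced_lstep) (auto simp: reduced_rev hd_rev)

lemma lstep_lstep_hd: "reduced E p \<Longrightarrow> lstep (hd p) (lstep w p) = p"
  by (cases p rule: remdups_adj.cases; cases "tl (tl p)") auto

lemma rstep_rstep_last: "reduced E p \<Longrightarrow> rstep (rstep p w) (last p) = p"
  using lstep_lstep_hd[of "rev p" w] by (simp add: rstep_def reduced_rev hd_rev)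

lemma reduced_transport: "reduced E p \<Longrightarrow> walk E (hd p) ws y \<Longrightarrow> reduced E (transport ws p)"
  by (induction ws arbitrary: p) (auto simp: reduced_lstep)

lemma transport_back:
  "reduced E p \<Longrightarrow> walk E (hd p) ws y \<Longrightarrow> transport (rev_walk (hd p) ws) (transport ws p) = p"
proof (induction ws arbitrary: p)
  case (Cons w ws)
  then show ?case
    using Cons.IH[of "lstep w p"] by (simp add: reduced_lstep lstep_lstep_hd)
qed simp

lemma prolong_back:
  assumes "reduced E p" "walk E (last p) ks y"
  shows "prolong (prolong p ks) (rev_walk (last p) ks) = p"
proof -
  have "transport (rev_walk (hd (rev p)) ks) (transport ks (rev p)) = rev p"
    using assms by (intro transport_back[where y = y]) (auto simp: reduced_rev hd_rev)
  then have "rev (prolong (prolong p ks) (rev_walk (last p) ks)) = rev p"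
    by (simp only: rev_prolong hd_rev)
  then show ?thesis
    by simp
qed

lemma transport_inj:
  assumes "reduced E p" "reduced E q" "hd p = hd q" "walk E (hd p) ws y"
      "transport ws p = transport ws q"
  shows "p = q"
  using transport_back[of p ws y] transport_back[of q ws y] assms by metis

lemma transport_conjugate_fixesD:
  assumes W: "walk E x W y" and ws: "walk E y ws y"
    and fixed: "transport (W @ ws @ rev_walk x W) [x] = [x]"
  shows "transport ws [y] = [y]"
proof -
  define p where "p = transport W [x]"
  have p: "reduced E p" "hd p = y"
    using W by (simp_all add: p_def reduced_transport hd_transport)
  have "transport (rev_walk x W) (transport ws p) = [x]"
    using fixed by (simp add: p_def)
  also have "\<dots> = transport (rev_walk x W) p"
    using transport_back[of "[x]" W y] W by (simp add: p_def)
  finally have "transport ws p = p"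
    using transport_inj[of "transport ws p" p "rev_walk x W" x] p ws walk_rev_walk[OF sym_E W]
    by (simp add: reduced_transport hd_transport reduced_not_Nil)
  then show ?thesis
    using transport_fixes_hd[of p ws] p by (simp add: reduced_not_Nil)
qed

lemma transport_alternate:
  "reduced E p \<Longrightarrow> transport (alternate (2 * n) y (hd p)) p = p"
  by (induction n) (auto simp: lstep_lstep_hd)

lemma prolong_eq_hdD:
  assumes "reduced E p" "reduced E q" "hd q = last p" "prolong p (tl q) = [hd p]"
  shows "q = rev p"
proof -
  have "q = prolong (transport (tl p) p) (tl q)"
    using assms prolong_hd_tl[OF assms(2)] by (simp add: transport_tl reduced_not_Nil)
  also have "\<dots> = transport (tl p) [hd p]"
    using assms(4) transport_prolong[of "tl p" p "tl q"] by simp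
  also have "\<dots> = rev p"
    using rev_prolong[of "[hd p]" "tl p"] prolong_hd_tl[OF assms(1)] by simp
  finally show ?thesis .
qed

end

section \<open>Ends of the universal cover\<close>

text \<open>An end of the universal cover is an infinite reduced walk.\<close>

definition end_step :: "'c \<Rightarrow> 'c stream \<Rightarrow> 'c stream" where
  "end_step w e = (if shd (stl e) = w then stl e else w ## e)"

abbreviation end_transport :: "'c list \<Rightarrow> 'c stream \<Rightarrow> 'c stream" where
  "end_transport \<equiv> fold end_step"

definition reduced_end :: "('c \<times> 'c) set \<Rightarrow> 'c stream \<Rightarrow> bool" where
  "reduced_end E e \<longleftrightarrow> (\<forall>n>0. reduced E (stake n e))"

lemma shd_end_step [simp]: "shd (end_step w e) = w"
  by (simp add: end_step_def)

lemma end_step_eq_tail: "end_step w e = stl e \<or> stl (end_step w e) = e"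
  by (simp add: end_step_def)

lemma end_step_shift: "2 \<le> length p \<Longrightarrow> end_step w (p @- e) = lstep w p @- e"
  by (cases p rule: remdups_adj.cases) (auto simp: end_step_def)

lemma end_transport_shift:
  "length ws < length p \<Longrightarrow> end_transport ws (p @- e) = transport ws p @- e"
proof (induction ws arbitrary: p)
  case (Cons w ws)
  then show ?case
    using length_le_lstep[of p w] by (simp add: end_step_shift)
qed simp

lemma end_transport_stake:
  "length ws < n \<Longrightarrow> end_transport ws e = transport ws (stake n e) @- sdrop n e"
  using end_transport_shift[of ws "stake n e" "sdrop n e"] by (simp add: stake_sdrop)

lemma stake_end_transport:
  assumes "m + length ws < n"
  shows "stake m (end_transport ws e) = take m (transport ws (stake n e))"
  using assms length_le_transport[of "stake n e" ws] end_transport_stake[of ws n e]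
  by (simp add: stake_shift)

lemma shd_end_transport: "walk E (shd e) ws y \<Longrightarrow> shd (end_transport ws e) = y"
  by (induction ws arbitrary: e) auto

lemma stream_eqI_stake: "(\<And>n. stake n s = stake n t) \<Longrightarrow> s = t"
  by (metis lessI smap_alt stake_nth stream.map_id0 id_apply)

lemma hd_stake: "0 < n \<Longrightarrow> hd (stake n e) = shd e"
  by (cases n) auto

lemma reduced_stake: "reduced_end E e \<Longrightarrow> 0 < n \<Longrightarrow> reduced E (stake n e)"
  by (simp add: reduced_end_def)

lemma reduced_end_arc:
  assumes "reduced_end E e"
  shows "(e !! i, e !! Suc i) \<in> E"
proof -
  have "reduced E (stake i e @ e !! i # [e !! Suc i])"
    using assms unfolding reduced_end_def
    by (metis stake_Suc append_Cons append_Nil append_assoc zero_less_Suc)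
  then show ?thesis
    by (subst (asm) reduced_append_Cons_iff) simp
qed

definition translates :: "'c list \<Rightarrow> 'c stream \<Rightarrow> bool" where
  "translates ws e \<longleftrightarrow>
     (\<exists>n d. 0 < n \<and> 0 < d \<and> transport ws (stake n e) = stake (n + d) e \<and>
         sdrop (n + d) e = sdrop n e)"

lemma stake_eq_prolong:
  assumes "reduced_end E e" "0 < n"
  shows "stake (n + j) e = prolong (stake n e) (stake j (sdrop n e))"
  using assms prolong_eq_append[of E "stake n e" "stake j (sdrop n e)"] by (simp add: reduced_stake)

lemma transport_stake_shift:
  assumes e: "reduced_end E e" and n: "0 < n"
    and ws: "transport ws (stake n e) = stake (n + d) e" "sdrop (n + d) e = sdrop n e"
  shows "transport ws (stake (n + j) e) = stake (n + d + j) e"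
proof -
  have "transport ws (stake (n + j) e) = prolong (stake (n + d) e) (stake j (sdrop (n + d) e))"
    by (simp only: stake_eq_prolong[OF e n] transport_prolong ws)
  then show ?thesis
    using stake_eq_prolong[OF e, of "n + d" j] n by simp
qed

lemma transport_power_stake:
  assumes "reduced_end E e" "0 < n"
    and "transport ws (stake n e) = stake (n + d) e" "sdrop (n + d) e = sdrop n e"
  shows "transport (concat (replicate k ws)) (stake n e) = stake (n + k * d) e"
proof (induction k)
  case (Suc k)
  have "concat (replicate (Suc k) ws) = concat (replicate k ws) @ ws"
    by (induction k) auto
  then show ?case
    using Suc transport_stake_shift[OF assms, of "k * d"] by (simp add: ac_simps)
qed simp

context loopless_graph
begin

lemma end_transport_cong:
  assumes "reduced_end E e"
    and "\<And>p. reduced E p \<Longrightarrow> hd p = shd e \<Longrightarrow> transport ws p = transport ws' p"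
  shows "end_transport ws e = end_transport ws' e"
proof -
  define n where "n = Suc (length ws + length ws')"
  have "0 < n"
    by (simp add: n_def)
  then have "transport ws (stake n e) = transport ws' (stake n e)"
    using assms(1) by (intro assms(2) reduced_stake hd_stake)
  then show ?thesis
    using end_transport_stake[of ws n e] end_transport_stake[of ws' n e] by (simp add: n_def)
qed

lemma reduced_end_transport:
  assumes "reduced_end E e" "walk E (shd e) ws y"
  shows "reduced_end E (end_transport ws e)"
  unfolding reduced_end_def
proof (intro allI impI)
  fix m :: nat assume m: "0 < m"
  let ?n = "Suc (m + length ws)"
  have "reduced E (transport ws (stake ?n e))"
    using assms by (intro reduced_transport[where y = y]) (auto simp: reduced_end_def)
  then show "reduced E (stake m (end_transport ws e))"
    using m by (simp only: stake_end_transport[of m ws ?n e, OF lessI] reduced_take)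
qed

lemma end_transport_back:
  assumes "reduced_end E e" "walk E (shd e) ws y"
  shows "end_transport (rev_walk (shd e) ws) (end_transport ws e) = e"
proof -
  have "transport (ws @ rev_walk (shd e) ws) p = transport [] p"
    if "reduced E p" "hd p = shd e" for p
    using transport_back[of p ws y] that assms(2) by simp
  from end_transport_cong[OF assms(1) this] show ?thesis
    by simp
qed

lemma end_transport_inj:
  assumes "reduced_end E e" "reduced_end E e'" "shd e = shd e'" "walk E (shd e) ws y"
    and "end_transport ws e = end_transport ws e'"
  shows "e = e'"
  using end_transport_back[of e ws y] end_transport_back[of e' ws y] assms by metis

text \<open>
  Every nontrivial closed walk is conjugate to a cyclically reduced one, whose powers have no
  cancellation. So its deck transformation is a translation, and the fundamental group is
  torsion-free.
\<close>

lemma reduced_closed_cases: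
  assumes "reduced E q" "last q = hd q" "q \<noteq> [hd q]"
  obtains u c where "q = u @ c @ rev u" "u \<noteq> []" "c \<noteq> []" "last c \<noteq> hd c"
proof -
  have "\<exists>u c. q = u @ c @ rev u \<and> u \<noteq> [] \<and> c \<noteq> [] \<and> last c \<noteq> hd c"
    using assms
  proof (induction q rule: length_induct)
    case (1 q)
    obtain x m where q: "q = x # m @ [x]"
      using 1(2-) by (cases q; cases "tl q" rule: rev_cases) auto
    with 1(2) irrefl_E[of x] have m: "m \<noteq> []"
      by (cases m) auto
    show ?case
    proof (cases "last m = hd m")
      case False
      then show ?thesis
        using q m by (intro exI[of _ "[x]"] exI[of _ m]) auto
    next
      case True
      have "reduced E (x # m)"
        using 1(2) reduced_appendD[of E "x # m" "[x]"] q by simp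
      then have "reduced E m"
        using m by (cases m) auto
      moreover have "m \<noteq> [hd m]"
        using 1(2) q by (cases m) auto
      ultimately obtain u c where "m = u @ c @ rev u" "u \<noteq> []" "c \<noteq> []" "last c \<noteq> hd c"
        using 1(1)[rule_format, of m] True q by auto
      then show ?thesis
        using q by (intro exI[of _ "x # u"] exI[of _ c]) auto
    qed
  qed
  then show thesis
    using that by blast
qed

lemma reduced_append_cyclic_power:
  assumes "reduced E (u @ c @ [last u])" "u \<noteq> []" "c \<noteq> []" "last c \<noteq> hd c"
  shows "reduced E (u @ concat (replicate k (c @ [last u])))"
proof -
  obtain v y where u: "u = v @ [y]"
    using assms(2) by (cases u rule: rev_cases) auto
  define power where "power k = concat (replicate k (c @ [y]))" for k
  have hd_power: "power k = [] \<or> hd (power k) = hd c" for k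
    using assms(3) by (cases k) (auto simp: power_def)
  have red: "reduced E (v @ [y])" "reduced E (y # c @ [y])" "v = [] \<or> last v \<noteq> hd c"
    using assms(1,3) reduced_append_Cons_iff[of E v y "c @ [y]"] by (auto simp: u)
  have "reduced E (y # power k)"
  proof (induction k)
    case (Suc k)
    have "y # power (Suc k) = (y # c) @ y # power k"
      by (simp add: power_def)
    then show ?case
      using Suc red(2) assms(3,4) hd_power[of k] reduced_append_Cons_iff[of E "y # c" y "power k"]
      by auto
  qed (simp add: power_def)
  then have "reduced E (v @ y # power k)"
    using red hd_power[of k] by (subst reduced_append_Cons_iff) auto
  then show ?thesis
    by (simp add: u power_def)
qed

lemma reduced_end_shift_cycle:
  assumes "reduced E (u @ c @ [last u])" "u \<noteq> []" "c \<noteq> []" "last c \<noteq> hd c"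
  shows "reduced_end E (u @- cycle (c @ [last u]))"
  unfolding reduced_end_def
proof (intro allI impI)
  fix n :: nat assume n: "0 < n"
  define d where "d = c @ [last u]"
  have "cycle d = concat (replicate k d) @- cycle d" for k
    by (induction k) (use cycle_decomp[of d] in \<open>auto simp: d_def\<close>)
  then have "u @- cycle d = (u @ concat (replicate n d)) @- cycle d"
    by (metis shift_append)
  moreover have "n \<le> length (u @ concat (replicate n d))"
    by (auto simp: length_concat sum_list_replicate d_def)
  ultimately have "stake n (u @- cycle d) = take n (u @ concat (replicate n d))"
    by (simp only: stake_shift) simp
  then show "reduced E (stake n (u @- cycle (c @ [last u])))"
    using reduced_take[OF reduced_append_cyclic_power[OF assms] n] by (simp add: d_def)
qed

lemma transport_conjugate:
  assumes q: "reduced E (u @ c @ rev u)" "u \<noteq> []" and ws: "transport ws [hd u] = u @ c @ rev u"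
  shows "transport ws u = u @ c @ [last u]"
proof -
  let ?p = "u @ c @ [last u]" and ?v = "tl (rev u)"
  have rev_u: "rev u = last u # ?v"
    using q(2) by (metis hd_Cons_tl hd_rev rev_is_Nil_conv)
  then have eq: "u @ c @ rev u = ?p @ ?v"
    by simp
  have red: "reduced E ?p" "reduced E u"
    using q reduced_appendD[of E ?p ?v] reduced_appendD[of E u] unfolding eq by auto
  have "transport ws u = prolong (?p @ ?v) (tl u)"
    using transport_from_hd[OF red(2), of ws] ws by (simp only: eq)
  also have "?p @ ?v = prolong ?p ?v"
    using prolong_eq_append[of E ?p ?v] q unfolding eq by simp
  also have "tl u = rev_walk (last ?p) ?v"
    using rev_u by (simp add: rev_walk_def butlast_rev flip: rev_u)
  also have "prolong (prolong ?p ?v) (rev_walk (last ?p) ?v) = ?p"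
    using walk_tl_reduced[of E "rev u"] red q(2)
    by (intro prolong_back[where y = "hd u"]) (simp_all add: reduced_rev hd_rev last_rev)
  finally show ?thesis .
qed

lemma exists_translated_end:
  assumes ws: "walk E x ws x" and nontriv: "transport ws [x] \<noteq> [x]"
  shows "\<exists>e. reduced_end E e \<and> shd e = x \<and> translates ws e"
proof -
  define q where "q = transport ws [x]"
  have q: "reduced E q" "hd q = x" "last q = x"
    using ws by (simp_all add: q_def reduced_transport hd_transport last_transport)
  then obtain u c where uc: "q = u @ c @ rev u" "u \<noteq> []" "c \<noteq> []" "last c \<noteq> hd c"
    using reduced_closed_cases[of q] nontriv by (metis q_def)
  define d where "d = c @ [last u]"
  define e where "e = u @- cycle d"
  have hd_u: "hd u = x"
    using q(2) uc by simp
  have transport_u: "transport ws u = u @ d"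
    using transport_conjugate[of u c ws] q(1) uc hd_u by (simp add: q_def d_def)
  have "d \<noteq> []"
    by (simp add: d_def)
  then have "stake (length u + length d) e = u @ d" "sdrop (length u + length d) e = cycle d"
      "stake (length u) e = u" "sdrop (length u) e = cycle d"
    by (simp_all add: e_def stake_shift sdrop_shift)
  then have "translates ws e"
    unfolding translates_def using uc(2) \<open>d \<noteq> []\<close> transport_u
    by (intro exI[of _ "length u"] exI[of _ "length d"]) simp
  moreover have "reduced E u"
    using q(1) uc(1,2) reduced_appendD[of E u] by simp
  then have "reduced E (u @ d)"
    using reduced_transport[of u ws x] ws hd_u transport_u by simp
  then have "reduced_end E e"
    unfolding e_def d_def using uc(2-4) by (rule reduced_end_shift_cycle)
  moreover have "shd e = x"
    using hd_u uc(2) by (simp add: e_def)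
  ultimately show ?thesis by blast
qed

lemma torsion_free:
  assumes "walk E x ws x" "transport (concat (replicate k ws)) [x] = [x]" "0 < k"
  shows "transport ws [x] = [x]"
proof (rule ccontr)
  assume "transport ws [x] \<noteq> [x]"
  then obtain e where e: "reduced_end E e" "shd e = x" "translates ws e"
    using exists_translated_end[OF assms(1)] by blast
  then obtain n d where n: "0 < n" "0 < d" "transport ws (stake n e) = stake (n + d) e"
      "sdrop (n + d) e = sdrop n e"
    unfolding translates_def by blast
  note power = transport_power_stake[OF e(1) n(1,3,4), of k]
  have "transport (concat (replicate k ws)) (stake n e) = stake n e"
    using e(1,2) n(1) assms(2)
    by (simp add: transport_fixes_if_fixes_hd[where E = E] reduced_stake hd_stake)
  with power have "length (stake n e) = length (stake (n + k * d) e)"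
    by simp
  then show False
    using n assms(3) by simp
qed

lemma translated_end_fixed:
  assumes e: "reduced_end E e" "translates ws e"
    and as: "walk E (shd e) as (shd e)"
    and comm: "\<And>p. reduced E p \<Longrightarrow> hd p = shd e \<Longrightarrow>
      transport as (transport ws p) = transport ws (transport as p)"
  shows "end_transport as e = e"
proof (rule stream_eqI_stake)
  fix m
  obtain n d where n: "0 < n" "0 < d" "transport ws (stake n e) = stake (n + d) e"
      "sdrop (n + d) e = sdrop n e"
    using e(2) unfolding translates_def by blast
  define s where "s k = stake (n + k * d) e" for k
  have s: "reduced E (s k)" "hd (s k) = shd e" for k
    using e(1) n(1) by (simp_all add: s_def reduced_end_def hd_stake)
  have s_Suc: "s (Suc k) = transport ws (s k)" for k
    using transport_stake_shift[OF e(1) n(1,3,4), of "k * d"] by (simp add: s_def ac_simps)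
  define r where "r = tl (rev (s 0)) @ tl (transport as (s 0))"
  have r: "transport as (s k) = prolong (s k) r" for k
  proof (induction k)
    case 0
    show ?case
      unfolding r_def
      by (subst prolong_from_to[of _ E])
        (use s[of 0] as in \<open>auto simp: reduced_transport hd_transport\<close>)
  next
    case (Suc k)
    then show ?case
      using comm[OF s] by (simp add: s_Suc transport_prolong)
  qed
  define k where "k = Suc (m + length r + length as)"
  have k: "k \<le> n + k * d"
    using n(2) by (simp add: trans_le_add2)
  have "stake m (end_transport as e) = take m (transport as (s k))"
    using k by (simp add: s_def k_def stake_end_transport)
  also have "\<dots> = take m (s k)"
    using k unfolding r by (intro take_prolong) (simp add: s_def k_def)
  also have "\<dots> = stake m e"
    using k by (simp add: s_def k_def take_stake min_def)
  finally show "stake m (end_transport as e) = stake m e" .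
qed

lemma fixed_end_translated:
  assumes ws: "walk E (shd e) ws (shd e)" "transport ws [shd e] \<noteq> [shd e]"
    and e: "reduced_end E e" "end_transport ws e = e"
  shows "translates ws e \<or> translates (rev_walk (shd e) ws) e"
proof -
  define n where "n = Suc (length ws)"
  define q where "q = transport ws (stake n e)"
  have n: "reduced E (stake n e)" "hd (stake n e) = shd e"
    using e(1) by (simp_all only: n_def reduced_stake hd_stake zero_less_Suc)
  have "e = q @- sdrop n e"
    using end_transport_stake[of ws n e] e(2) by (simp add: q_def n_def)
  then have "stake (length q) e = stake (length q) (q @- sdrop n e)"
      "sdrop (length q) e = sdrop (length q) (q @- sdrop n e)"
    by (rule arg_cong)+
  then have q: "q = stake (length q) e" "sdrop (length q) e = sdrop n e"
    by (simp_all add: stake_shift sdrop_shift)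
  have "0 < length q" "0 < n"
    using n by (auto simp: q_def n_def)
  have "length q \<noteq> n"
    using transport_fixes_hd[of "stake n e" ws] n ws(2) q(1) by (metis q_def reduced_not_Nil)
  then consider "n < length q" | "length q < n"
    by linarith
  then show ?thesis
  proof cases
    case 1
    then have "translates ws e"
      unfolding translates_def using \<open>0 < n\<close> q
      by (intro exI[of _ n] exI[of _ "length q - n"]) (simp flip: q_def)
    then show ?thesis ..
  next
    case 2
    have "transport (rev_walk (shd e) ws) q = stake n e"
      using transport_back[of "stake n e" ws "shd e"] n ws(1) by (simp add: q_def)
    with 2 have "translates (rev_walk (shd e) ws) e"
      unfolding translates_def using \<open>0 < length q\<close> q
      by (intro exI[of _ "length q"] exI[of _ "n - length q"]) simp
    then show ?thesis ..
  qed
qed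

lemma commuting_fixes_end:
  assumes ws: "walk E (shd e) ws (shd e)" "transport ws [shd e] \<noteq> [shd e]"
    and e: "reduced_end E e" "end_transport ws e = e"
    and as: "walk E (shd e) as (shd e)"
    and comm: "\<And>p. reduced E p \<Longrightarrow> hd p = shd e \<Longrightarrow>
      transport as (transport ws p) = transport ws (transport as p)"
  shows "end_transport as e = e"
  using fixed_end_translated[OF ws e]
proof
  assume "translates ws e"
  then show ?thesis
    using translated_end_fixed e(1) as comm by blast
next
  let ?ws' = "rev_walk (shd e) ws"
  assume "translates ?ws' e"
  moreover have "transport as (transport ?ws' p) = transport ?ws' (transport as p)"
    if p: "reduced E p" "hd p = shd e" for p
  proof -
    let ?p' = "transport ?ws' p"
    have ws': "walk E (shd e) ?ws' (shd e)"
      using walk_rev_walk[OF sym_E ws(1)] .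
    have p': "reduced E ?p'" "hd ?p' = shd e"
      using p ws' by (auto simp: reduced_transport hd_transport)
    have "rev_walk (shd e) ?ws' = ws"
      using rev_walk_rev_walk[of "shd e" ws] walk_last[OF ws(1)] by metis
    then have "transport ws ?p' = p"
      using transport_back[of p ?ws' "shd e"] p ws' by simp
    then have "transport ?ws' (transport as p) = transport ?ws' (transport ws (transport as ?p'))"
      using comm[OF p'] by simp
    also have "\<dots> = transport as ?p'"
      using transport_back[of "transport as ?p'" ws "shd e"] p' as ws(1)
      by (simp add: reduced_transport hd_transport reduced_not_Nil)
    finally show ?thesis
      by simp
  qed
  ultimately show ?thesis
    using translated_end_fixed e(1) as by blast
qed

lemma square_fixes_end:
  assumes ws: "walk E (shd e) ws (shd e)"
    and e: "reduced_end E e" "end_transport (ws @ ws) e = e"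
  shows "end_transport ws e = e"
proof (cases "transport (ws @ ws) [shd e] = [shd e]")
  case True
  then have "transport ws [shd e] = [shd e]"
    using torsion_free[OF ws, of 2] by (simp add: numeral_2_eq_2)
  then have "transport ws p = transport [] p" if "reduced E p" "hd p = shd e" for p
    using transport_fixes_if_fixes_hd[of ws p E] that by simp
  from end_transport_cong[OF e(1) this] show ?thesis
    by simp
next
  case False
  have "walk E (shd e) (ws @ ws) (shd e)"
    using ws by (auto simp: walk_append)
  from commuting_fixes_end[OF this False e ws] show ?thesis
    by simp
qed

lemma fixed_end_extends:
  assumes R: "sym R" "\<And>v. v \<in> V \<Longrightarrow> \<exists>W. walk R v0 W v" "R \<subseteq> V \<times> V"
    and hom: "\<And>u v. (u, v) \<in> R \<Longrightarrow> (f u, f v) \<in> E"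
    and e: "reduced_end E e" "shd e = f v0"
    and fixed: "\<And>W. walk R v0 W v0 \<Longrightarrow> end_transport (map f W) e = e"
  shows "\<exists>\<epsilon>. (\<forall>v\<in>V. reduced_end E (\<epsilon> v) \<and> shd (\<epsilon> v) = f v) \<and>
    (\<forall>(u, v)\<in>R. \<epsilon> v = end_step (f v) (\<epsilon> u))"
proof -
  obtain W where W: "walk R v0 (W v) v" if "v \<in> V" for v
    using R(2) by metis
  define \<epsilon> where "\<epsilon> v = end_transport (map f (W v)) e" for v
  have walk_W: "walk E (shd e) (map f (W v)) (f v)" if "v \<in> V" for v
    unfolding e(2) by (rule walk_map[OF W[OF that] hom])
  have \<epsilon>: "reduced_end E (\<epsilon> v)" "shd (\<epsilon> v) = f v" if "v \<in> V" for v
    using reduced_end_transport[OF e(1) walk_W[OF that]] shd_end_transport[OF walk_W[OF that]]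
    by (simp_all add: \<epsilon>_def)
  have "\<epsilon> v = end_step (f v) (\<epsilon> u)" if uv: "(u, v) \<in> R" for u v
  proof -
    have V: "u \<in> V" "v \<in> V"
      using uv R(3) by auto
    let ?R = "rev_walk (shd e) (map f (W v))" and ?s = "end_step (f v) (\<epsilon> u)"
    have walk_R: "walk E (f v) ?R (shd e)"
      using walk_rev_walk[OF sym_E walk_W[OF V(2)]] .
    have s: "?s = end_transport (map f (W u @ [v])) e"
      by (simp add: \<epsilon>_def)
    have "walk E (shd e) (map f (W u @ [v])) (f v)"
      using walk_W[OF V(1)] hom[OF uv] by (auto simp: walk_append)
    then have red_s: "reduced_end E ?s"
      unfolding s by (rule reduced_end_transport[OF e(1)])
    have "walk R v0 (W u @ v # rev_walk v0 (W v)) v0"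
      using W[OF V(1)] uv walk_rev_walk[OF R(1) W[OF V(2)]] by (auto simp: walk_append)
    from fixed[OF this] have "end_transport ?R ?s = end_transport ?R (\<epsilon> v)"
      using end_transport_back[OF e(1) walk_W[OF V(2)]] by (simp add: \<epsilon>_def map_rev_walk e(2))
    then show ?thesis
      using end_transport_inj[OF red_s \<epsilon>(1)[OF V(2)], of ?R "shd e"] \<epsilon>(2)[OF V(2)] walk_R by simp
  qed
  with \<epsilon> show ?thesis
    by (intro exI[of _ \<epsilon>]) auto
qed

end

section \<open>Homotopies of walks\<close>

inductive homotopic :: "('a \<times> 'a) set \<Rightarrow> 'a \<Rightarrow> 'a \<Rightarrow> 'a list \<Rightarrow> 'a list \<Rightarrow> bool" for E where
  refl: "walk E x us y \<Longrightarrow> homotopic E x y us us"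
| Cons: "(x, u) \<in> E \<Longrightarrow> homotopic E u y us us' \<Longrightarrow> homotopic E x y (u # us) (u # us')"
| swap: "(x, a) \<in> E \<Longrightarrow> (a, c) \<in> E \<Longrightarrow> (x, b) \<in> E \<Longrightarrow> (b, c) \<in> E \<Longrightarrow> walk E c us y \<Longrightarrow>
    homotopic E x y (a # c # us) (b # c # us)"
| trans: "homotopic E x y us us' \<Longrightarrow> homotopic E x y us' us'' \<Longrightarrow> homotopic E x y us us''"

lemma homotopic_length: "homotopic E x y us us' \<Longrightarrow> length us = length us'"
  by (induction rule: homotopic.induct) auto

lemma homotopic_sym: "homotopic E x y us us' \<Longrightarrow> homotopic E x y us' us"
  by (induction rule: homotopic.induct) (auto intro: homotopic.intros)

lemma homotopic_append:
  "homotopic E x y us us' \<Longrightarrow> walk E y vs z \<Longrightarrow> homotopic E x z (us @ vs) (us' @ vs)"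
  by (induction rule: homotopic.induct) (auto intro: homotopic.intros walk_appendI)

lemma homotopic_graph_hom:
  assumes "graph_hom G K f" "homotopic (parcs G) u v us us'"
  shows "homotopic (parcs K) (f u) (f v) (map f us) (map f us')"
  using assms(2)
  by (induction rule: homotopic.induct)
    (auto intro: homotopic.intros walk_graph_hom[OF assms(1)] graph_hom_arcD[OF assms(1)])

lemma (in loopless_graph) transport_eq_if_homotopic:
  assumes square_free: "\<And>a b c d. (a, b) \<in> E \<Longrightarrow> (b, c) \<in> E \<Longrightarrow> (c, d) \<in> E \<Longrightarrow> (d, a) \<in> E \<Longrightarrow>
      a = c \<or> b = d"
    and "homotopic E x y us us'" "reduced E p" "hd p = x"
  shows "transport us p = transport us' p"
  using assms(2-)
proof (induction arbitrary: p rule: homotopic.induct)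
  case (Cons x u y us us')
  then show ?case
    using reduced_lstep[of p u] by simp
next
  case (swap x a c b us y)
  have "x = c \<or> a = b"
    using square_free[OF swap.hyps(1,2) symD[OF sym_E swap.hyps(4)] symD[OF sym_E swap.hyps(3)]] .
  then have "lstep c (lstep a p) = lstep c (lstep b p)"
    using lstep_lstep_hd[OF swap.prems(1)] swap.prems(2) by auto
  then show ?case
    by simp
qed auto

lemma homotopic_alternate:
  assumes "sym E" "(x, a) \<in> E" "(x, b) \<in> E"
  shows "homotopic E x x (alternate (2 * k) a x) (alternate (2 * k) b x)"
proof (induction k)
  case (Suc k)
  have "walk E x (alternate (2 * k) a x) x"
    using walk_alternate[OF assms(1,2), of "2 * k"] by simp
  then have "homotopic E x x (a # x # alternate (2 * k) a x) (b # x # alternate (2 * k) a x)"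
    using assms by (intro homotopic.swap) (auto dest: symD)
  moreover have "homotopic E x x (b # x # alternate (2 * k) a x) (b # x # alternate (2 * k) b x)"
    using assms Suc by (intro homotopic.Cons) (auto dest: symD)
  ultimately show ?case
    by (auto intro: homotopic.trans)
qed (simp add: homotopic.refl)

text \<open>
  Backtracks pad walks in the two factors of a tensor product to the same length. They can be
  moved along a walk, which leaves room to change the walk in one factor while the other one
  stays fixed.
\<close>

lemma homotopic_move_backtrack:
  assumes "sym E" "walk E x us y" "(x, a) \<in> E" "(y, b) \<in> E"
  shows "homotopic E x y (a # x # us) (us @ [b, y])"
  using assms(2,3)
proof (induction us arbitrary: x a)
  case Nil
  then show ?case
    using assms(1,4) by (auto intro!: homotopic.swap dest: symD)
next
  case (Cons u us)
  then have xu: "(x, u) \<in> E" "(u, x) \<in> E" and us: "walk E u us y"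
    using assms(1) by (auto dest: symD)
  have "homotopic E x y (a # x # u # us) (u # x # u # us)"
    using xu us symD[OF assms(1) Cons.prems(2)] Cons.prems(2) by (intro homotopic.swap) auto
  moreover have "homotopic E x y (u # x # u # us) (u # us @ [b, y])"
    using Cons.IH[OF us xu(2)] xu(1) by (rule homotopic.Cons[rotated])
  ultimately show ?case
    by (auto intro: homotopic.trans)
qed

lemma homotopic_move_alternate:
  assumes "sym E" "walk E x us y" "(x, a) \<in> E" "(y, b) \<in> E"
  shows "homotopic E x y (alternate (2 * k) a x @ us) (us @ alternate (2 * k) b y)"
proof (induction k)
  case (Suc k)
  have "homotopic E x y (a # x # (alternate (2 * k) a x @ us))
      (a # x # (us @ alternate (2 * k) b y))"
    by (intro homotopic.Cons Suc assms symD[OF assms(1,3)])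
  moreover have "homotopic E x y ((a # x # us) @ alternate (2 * k) b y)
      ((us @ [b, y]) @ alternate (2 * k) b y)"
    using walk_alternate[OF assms(1,4), of "2 * k"]
    by (intro homotopic_append[OF homotopic_move_backtrack[OF assms]]) auto
  ultimately show ?case
    by (auto intro: homotopic.trans)
qed (simp add: homotopic.refl assms)

lemma homotopic_conjugate_alternate:
  assumes "sym E" "walk E x us y" "(y, a) \<in> E" "(x, b) \<in> E"
  shows "homotopic E x x (us @ alternate (2 * k) a y @ rev_walk x us)
    (alternate (2 * (k + length us)) b x)"
  using assms(2,4)
proof (induction us arbitrary: x b)
  case Nil
  then show ?case
    using homotopic_alternate[OF assms(1) assms(3)] by simp
next
  case (Cons u us)
  then have xu: "(x, u) \<in> E" "(u, x) \<in> E" and us: "walk E u us y"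
    using assms(1) by (auto dest: symD)
  let ?m = "k + length us"
  have "homotopic E u x ((us @ alternate (2 * k) a y @ rev_walk u us) @ [x])
      (alternate (2 * ?m) x u @ [x])"
    using Cons.IH[OF us xu(2)] xu by (intro homotopic_append) auto
  moreover have "alternate (2 * ?m) x u @ [x] = x # alternate (2 * ?m) u x"
    using alternate_snoc[of "2 * ?m" x u] by simp
  ultimately have "homotopic E x x (u # (us @ alternate (2 * k) a y @ rev_walk u us) @ [x])
      (alternate (2 * Suc ?m) u x)"
    using homotopic.Cons[OF xu(1)] by simp
  from homotopic.trans[OF this homotopic_alternate[OF assms(1) xu(1) Cons.prems(2)]] show ?case
    by simp
qed

lemma homotopic_zip_left:
  assumes "homotopic (parcs G) g g' us us'" "walk (parcs H) h vs h'" "length vs = length us"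
  shows "homotopic (parcs (tensor_product G H)) (g, h) (g', h') (zip us vs) (zip us' vs)"
  using assms
proof (induction arbitrary: h vs rule: homotopic.induct)
  case (refl g us g')
  then show ?case
    by (intro homotopic.refl) (simp add: walk_zip_iff)
next
  case (Cons g u g' us us')
  then obtain v vs' where "vs = v # vs'"
    by (cases vs) auto
  with Cons show ?case
    by (auto intro: homotopic.Cons)
next
  case (swap g a c b us g')
  then obtain v w vs' where "vs = v # w # vs'"
    by (cases vs; cases "tl vs") auto
  with swap show ?case
    by (auto intro!: homotopic.swap simp: walk_zip_iff)
next
  case (trans g g' us us' us'')
  then show ?case
    using homotopic_length[OF trans.hyps(1)] by (metis homotopic.trans)
qed

lemma homotopic_zip_right:
  assumes "homotopic (parcs H) h h' vs vs'" "walk (parcs G) g us g'" "length us = length vs"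
  shows "homotopic (parcs (tensor_product G H)) (g, h) (g', h') (zip us vs) (zip us vs')"
proof -
  have "homotopic (parcs (tensor_product H G)) (h, g) (h', g') (zip vs us) (zip vs' us)"
    using homotopic_zip_left[OF assms] .
  from homotopic_graph_hom[OF graph_hom_swap this] show ?thesis
    by (simp add: zip_eq_map_swap_zip[of us vs] zip_eq_map_swap_zip[of us vs'])
qed

definition row :: "'a list \<Rightarrow> 'b \<Rightarrow> 'b \<Rightarrow> ('a \<times> 'b) list" where
  "row us h h' = zip us (alternate (length us) h' h)"

definition column :: "'b list \<Rightarrow> 'a \<Rightarrow> 'a \<Rightarrow> ('a \<times> 'b) list" where
  "column vs g g' = zip (alternate (length vs) g' g) vs"

lemma row_simps [simp]:
  "row [] h h' = []"
  "row (u # v # us) h h' = (u, h') # (v, h) # row us h h'"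
  by (simp_all add: row_def)

lemma length_row [simp]: "length (row us h h') = length us"
  by (simp add: row_def)

lemma row_append: "even (length us) \<Longrightarrow> row (us @ vs) h h' = row us h h' @ row vs h h'"
  by (simp add: row_def alternate_append)

lemma row_Cons_snoc:
  "even (length us) \<Longrightarrow> row (u # us @ [v]) h h' = (u, h') # row us h' h @ [(v, h)]"
  using row_append[of us "[v]" h' h] by (simp add: row_def)

lemma map_swap_row: "map prod.swap (row vs g g') = column vs g g'"
  by (simp add: row_def column_def zip_eq_map_swap_zip[of _ vs])

lemma rev_walk_row: "even (length us) \<Longrightarrow> rev_walk (g, h) (row us h h') = row (rev_walk g us) h h'"
  by (simp add: row_def rev_walk_zip rev_walk_alternate)

lemma walk_row:
  assumes "sym (parcs H)" "walk (parcs G) g us g'" "even (length us)" "(h, h') \<in> parcs H"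
  shows "walk (parcs (tensor_product G H)) (g, h) (row us h h') (g', h)"
  using assms walk_alternate[OF assms(1,4), of "length us"] by (simp add: row_def walk_zip_iff)

lemma walk_column:
  assumes "sym (parcs G)" "walk (parcs H) h vs h'" "even (length vs)" "(g, g') \<in> parcs G"
  shows "walk (parcs (tensor_product G H)) (g, h) (column vs g g') (g, h')"
  using assms walk_alternate[OF assms(1,4), of "length vs"] by (simp add: column_def walk_zip_iff)

lemma homotopic_row_change_neighbour:
  assumes "sym (parcs H)" "walk (parcs G) g us g'" "even (length us)"
    and "(h, h1) \<in> parcs H" "(h, h2) \<in> parcs H"
  shows "homotopic (parcs (tensor_product G H)) (g, h) (g', h) (row us h h1) (row us h h2)"
  using homotopic_zip_right[OF homotopic_alternate[OF assms(1,4,5), of "length us div 2"] assms(2)]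
    assms(3)
  by (simp add: row_def)

lemma homotopic_row_column_diagonal:
  assumes G: "sym (parcs G)" "walk (parcs G) g us g'" "even (length us)" "(g', g1) \<in> parcs G"
    and H: "sym (parcs H)" "walk (parcs H) h vs h'" "even (length vs)" "(h, h0) \<in> parcs H"
        "(h', h1) \<in> parcs H"
  shows "homotopic (parcs (tensor_product G H)) (g, h) (g', h')
    (row us h h0 @ column vs g' g1)
    (zip (us @ alternate (length vs) g1 g') (vs @ alternate (length us) h1 h'))"
proof -
  have "walk (parcs G) g (us @ alternate (length vs) g1 g') g'"
    using G H(3) walk_alternate[OF G(1,4), of "length vs"] by (auto simp: walk_append)
  from homotopic_zip_right[OF homotopic_move_alternate[OF H(1,2,4,5), of "length us div 2"] this]
  show ?thesis
    using G(3) by (simp add: row_def column_def)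
qed

lemma homotopic_row_column:
  assumes G: "sym (parcs G)" "walk (parcs G) g us g'" "even (length us)" "(g, g0) \<in> parcs G"
      "(g', g1) \<in> parcs G"
    and H: "sym (parcs H)" "walk (parcs H) h vs h'" "even (length vs)" "(h, h0) \<in> parcs H"
        "(h', h1) \<in> parcs H"
  shows "homotopic (parcs (tensor_product G H)) (g, h) (g', h')
    (column vs g g0 @ row us h' h1) (row us h h0 @ column vs g' g1)"
proof -
  have "walk (parcs H) h (vs @ alternate (length us) h1 h') h'"
    using H G(3) walk_alternate[OF H(1,5), of "length us"] by (auto simp: walk_append)
  from homotopic_zip_left[OF homotopic_move_alternate[OF G(1,2,4,5), of "length vs div 2"] this]
  have "homotopic (parcs (tensor_product G H)) (g, h) (g', h') (column vs g g0 @ row us h' h1)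
      (zip (us @ alternate (length vs) g1 g') (vs @ alternate (length us) h1 h'))"
    using H(3) by (simp add: row_def column_def)
  then show ?thesis
    by (rule homotopic.trans[OF _ homotopic_sym[OF homotopic_row_column_diagonal[OF G(1-3,5) H]]])
qed

lemma homotopic_conjugate_row:
  assumes G: "sym (parcs G)" "walk (parcs G) g us g'" "walk (parcs G) g' ws g'" "even (length ws)"
    and H: "sym (parcs H)" "walk (parcs H) h vs h'" "(h', h1') \<in> parcs H" "(h, h1) \<in> parcs H"
    and len: "length us = length vs"
  shows "homotopic (parcs (tensor_product G H)) (g, h) (g, h)
    (zip us vs @ row ws h' h1' @ rev_walk (g, h) (zip us vs)) (row (us @ ws @ rev_walk g us) h h1)"
proof -
  let ?us' = "us @ ws @ rev_walk g us" and ?k = "length ws div 2"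
  have "walk (parcs G) g ?us' g"
    using G walk_rev_walk[OF G(1,2)] by (auto intro: walk_appendI)
  moreover have "length ?us' = 2 * (?k + length vs)"
    using G(4) len by simp
  ultimately have "homotopic (parcs (tensor_product G H)) (g, h) (g, h)
      (zip ?us' (vs @ alternate (2 * ?k) h1' h' @ rev_walk h vs)) (row ?us' h h1)"
    using homotopic_zip_right[OF homotopic_conjugate_alternate[OF H(1-4)], of G g ?us' g ?k]
    by (simp add: row_def)
  moreover have "zip ?us' (vs @ alternate (2 * ?k) h1' h' @ rev_walk h vs) =
      zip us vs @ row ws h' h1' @ rev_walk (g, h) (zip us vs)"
    using G(4) len by (simp add: row_def rev_walk_zip)
  ultimately show ?thesis
    by (simp only:)
qed

section \<open>Colorings of tensor products\<close>

locale tensor_coloring =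
  fixes G :: "'a pair_pre_digraph" and H :: "'b pair_pre_digraph" and K :: "'c pair_pre_digraph"
    and f :: "'a \<times> 'b \<Rightarrow> 'c"
  assumes proper_G: "proper_graph G" and proper_H: "proper_graph H" and proper_K: "proper_graph K"
    and parity_connected_G: "parity_connected G" and parity_connected_H: "parity_connected H"
    and hom: "graph_hom (tensor_product G H) K f"
begin

sublocale loopless_graph "parcs K"
  by unfold_locales (rule proper_graph_sym[OF proper_K], rule proper_graph_irrefl[OF proper_K])

abbreviation GH :: "('a \<times> 'b) pair_pre_digraph" where
  "GH \<equiv> tensor_product G H"

lemmas sym_G = proper_graph_sym[OF proper_G] and sym_H = proper_graph_sym[OF proper_H]
lemmas subset_G = proper_graph_subset[OF proper_G] and subset_H = proper_graph_subset[OF proper_H]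
lemmas neighbour_G = proper_graph_neighbour[OF proper_G]
lemmas neighbour_H = proper_graph_neighbour[OF proper_H]
lemmas proper_GH = proper_graph_tensor_product[OF proper_G proper_H]
lemmas parity_connected_GH =
  parity_connected_tensor_product[OF proper_G parity_connected_G proper_H parity_connected_H]
lemmas even_walk_G = parity_connectedE[OF parity_connected_G, where c = True, simplified]

lemma walk_hom: "walk (parcs GH) v W w \<Longrightarrow> walk (parcs K) (f v) (map f W) (f w)"
  by (rule walk_graph_hom[OF hom])

lemma connected_GH: "v \<in> pverts GH \<Longrightarrow> w \<in> pverts GH \<Longrightarrow> \<exists>W. walk (parcs GH) v W w"
  using parity_connected_GH unfolding parity_connected_def by blast

lemma walk_hom_row:
  assumes "walk (parcs G) g us g'" "even (length us)" "(h, h') \<in> parcs H"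
  shows "walk (parcs K) (f (g, h)) (map f (row us h h')) (f (g', h))"
  by (rule walk_hom[OF walk_row[OF sym_H assms]])

lemma walk_hom_column:
  assumes "walk (parcs H) h vs h'" "even (length vs)" "(g, g') \<in> parcs G"
  shows "walk (parcs K) (f (g, h)) (map f (column vs g g')) (f (g, h'))"
  by (rule walk_hom[OF walk_column[OF sym_G assms]])

end

definition left_trivial :: "'a pair_pre_digraph \<Rightarrow> 'b pair_pre_digraph \<Rightarrow> ('a \<times> 'b \<Rightarrow> 'c) \<Rightarrow> bool" where
  "left_trivial G H f \<longleftrightarrow>
     (\<forall>g\<in>pverts G. \<forall>us h h'. walk (parcs G) g us g \<and> even (length us) \<and> (h, h') \<in> parcs H \<longrightarrow>
        transport (map f (row us h h')) [f (g, h)] = [f (g, h)])"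

lemma left_trivialD:
  "left_trivial G H f \<Longrightarrow> g \<in> pverts G \<Longrightarrow> walk (parcs G) g us g \<Longrightarrow> even (length us) \<Longrightarrow>
    (h, h') \<in> parcs H \<Longrightarrow> transport (map f (row us h h')) [f (g, h)] = [f (g, h)]"
  unfolding left_trivial_def by blast

locale square_free_tensor_coloring = tensor_coloring G H K f
  for G :: "'a pair_pre_digraph" and H :: "'b pair_pre_digraph" and K :: "'c pair_pre_digraph"
      and f +
  assumes square_free_K: "square_free K"
begin

lemma square_free_tensor_coloring_swap: "square_free_tensor_coloring H G K (f \<circ> prod.swap)"
  by unfold_locales
    (rule proper_G proper_H proper_K parity_connected_G parity_connected_H square_free_K
      graph_hom_comp[OF graph_hom_swap hom])+

lemma transport_homotopic:
  assumes "homotopic (parcs GH) v w W W'" "reduced (parcs K) p" "hd p = f v"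
  shows "transport (map f W) p = transport (map f W') p"
  using square_freeD[OF square_free_K proper_K] homotopic_graph_hom[OF hom assms(1)] assms(2,3)
  by (rule transport_eq_if_homotopic)

text \<open>
  Walks to another vertex conjugate the deck transformations, so triviality at one vertex
  suffices.
\<close>

lemma left_trivialI:
  assumes g0: "g0 \<in> pverts G" and h0: "(h0, h1) \<in> parcs H"
    and triv: "\<And>us. walk (parcs G) g0 us g0 \<Longrightarrow> even (length us) \<Longrightarrow>
      transport (map f (row us h0 h1)) [f (g0, h0)] = [f (g0, h0)]"
  shows "left_trivial G H f"
  unfolding left_trivial_def
proof (intro ballI allI impI, elim conjE)
  fix g us h h' assume g: "g \<in> pverts G" and us: "walk (parcs G) g us g" "even (length us)"
    and h: "(h, h') \<in> parcs H"
  have "h0 \<in> pverts H" "h \<in> pverts H"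
    using h0 h subset_H by auto
  then obtain W where W: "walk (parcs GH) (g0, h0) W (g, h)"
    using connected_GH[of "(g0, h0)" "(g, h)"] g0 g by auto
  then obtain ws vs where wv: "W = zip ws vs" "length ws = length vs"
      "walk (parcs G) g0 ws g" "walk (parcs H) h0 vs h"
    by (rule walk_tensor_productE)
  let ?us' = "ws @ us @ rev_walk g0 ws"
  have "homotopic (parcs GH) (g0, h0) (g0, h0) (W @ row us h h' @ rev_walk (g0, h0) W)
      (row ?us' h0 h1)"
    unfolding wv(1) by (rule homotopic_conjugate_row[OF sym_G wv(3) us sym_H wv(4) h h0 wv(2)])
  then have "transport (map f (W @ row us h h' @ rev_walk (g0, h0) W)) [f (g0, h0)] =
      transport (map f (row ?us' h0 h1)) [f (g0, h0)]"
    by (rule transport_homotopic) simp_all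
  also have "\<dots> = [f (g0, h0)]"
    using wv(3) us walk_rev_walk[OF sym_G wv(3)] by (intro triv) (auto intro: walk_appendI)
  finally show "transport (map f (row us h h')) [f (g, h)] = [f (g, h)]"
    using transport_conjugate_fixesD[OF walk_hom[OF W] walk_hom_row[OF us h]]
    by (simp add: map_rev_walk)
qed

lemma row_column_commute:
  assumes "walk (parcs G) g us g" "even (length us)" "walk (parcs H) h vs h" "even (length vs)"
    and "(g, g') \<in> parcs G" "(h, h') \<in> parcs H" and p: "reduced (parcs K) p" "hd p = f (g, h)"
  shows "transport (map f (column vs g g')) (transport (map f (row us h h')) p) =
    transport (map f (row us h h')) (transport (map f (column vs g g')) p)"
  using transport_homotopic[OF homotopic_row_column[OF sym_G assms(1,2,5,5) sym_H assms(3,4,6,6)] p]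
  by simp

text \<open>
  A closed walk of odd length does not split into closed walks of the two factors, but its
  square does.
\<close>

lemma square_eq_row_column:
  assumes W: "walk (parcs GH) (g, h) W (g, h)" and arcs: "(g, g') \<in> parcs G" "(h, h') \<in> parcs H"
  obtains us vs where "walk (parcs G) g us g" "even (length us)" "walk (parcs H) h vs h"
      "even (length vs)"
    "\<And>p. reduced (parcs K) p \<Longrightarrow> hd p = f (g, h) \<Longrightarrow>
       transport (map f (W @ W)) p = transport (map f (row us h h' @ column vs g g')) p"
proof -
  have WW: "walk (parcs GH) (g, h) (W @ W) (g, h)"
    using W by (rule walk_appendI[OF _ W])
  then obtain us vs where uv: "W @ W = zip us vs" "length us = length vs" "walk (parcs G) g us g"
      "walk (parcs H) h vs h"
    by (rule walk_tensor_productE)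
  have even: "even (length us)" "even (length vs)"
    using uv(2) arg_cong[OF uv(1), of length] by (auto simp: uv(2) dest: sym)
  have "transport (map f (W @ W)) p = transport (map f (row us h h' @ column vs g g')) p"
    if p: "reduced (parcs K) p" "hd p = f (g, h)" for p
  proof -
    let ?q = "transport (map f (W @ W)) p"
    have q: "reduced (parcs K) ?q" "hd ?q = f (g, h)"
      using p walk_hom[OF WW] reduced_transport[of p] hd_transport[of p] by (metis reduced_not_Nil)+
    have "transport (map f (row us h h' @ column vs g g')) p =
        transport
          (map f (zip (us @ alternate (length vs) g' g) (vs @ alternate (length us) h' h))) p"
      using transport_homotopic[OF homotopic_row_column_diagonal[OF sym_G uv(3) even(1) arcs(1)
        sym_H uv(4) even(2) arcs(2,2)] p] .
    also have "\<dots> = transport (alternate (length us) (f (g', h')) (f (g, h))) ?q"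
      using uv(1,2) by (simp add: zip_alternate map_alternate)
    also have "\<dots> = ?q"
      using transport_alternate[OF q(1), of "length us div 2" "f (g', h')"] q(2) even(1) by simp
    finally show ?thesis ..
  qed
  then show thesis
    using that uv(3,4) even by blast
qed

lemma exists_end_fixed_by_rows_and_columns:
  assumes nontriv: "\<not> left_trivial G H f" "\<not> left_trivial H G (f \<circ> prod.swap)"
    and arcs: "(g, g') \<in> parcs G" "(h, h') \<in> parcs H"
  obtains e where "reduced_end (parcs K) e" "shd e = f (g, h)"
    "\<And>us. walk (parcs G) g us g \<Longrightarrow> even (length us) \<Longrightarrow> end_transport (map f (row us h h')) e = e"
    "\<And>vs. walk (parcs H) h vs h \<Longrightarrow> even (length vs) \<Longrightarrow> end_transport (map f (column vs g g')) e = e"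
proof -
  let ?x = "f (g, h)"
  interpret swap: square_free_tensor_coloring H G K "f \<circ> prod.swap"
    by (rule square_free_tensor_coloring_swap)
  have V: "g \<in> pverts G" "h \<in> pverts H"
    using arcs subset_G subset_H by auto
  define a where "a us = map f (row us h h')" for us
  define b where "b vs = map f (column vs g g')" for vs
  note walk_a = walk_hom_row[OF _ _ arcs(2), of g _ g, folded a_def]
  note walk_b = walk_hom_column[OF _ _ arcs(1), of h _ h, folded b_def]
  note commute = row_column_commute[OF _ _ _ _ arcs, folded a_def b_def]
  obtain us where us: "walk (parcs G) g us g" "even (length us)" "transport (a us) [?x] \<noteq> [?x]"
    using left_trivialI[OF V(1) arcs(2)] nontriv(1) by (auto simp: a_def)
  obtain vs where vs: "walk (parcs H) h vs h" "even (length vs)" "transport (b vs) [?x] \<noteq> [?x]"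
    using swap.left_trivialI[OF V(2) arcs(1)] nontriv(2)
    by (auto simp: b_def simp flip: map_swap_row)
  obtain e where e: "reduced_end (parcs K) e" "shd e = ?x" "translates (a us) e"
    using exists_translated_end[OF walk_a[OF us(1,2)] us(3)] by blast
  have fix_b: "end_transport (b vs) e = e" if "walk (parcs H) h vs h" "even (length vs)" for vs
    using translated_end_fixed[OF e(1,3), of "b vs"] walk_b[OF that] commute[OF us(1,2) that] e(2)
    by simp
  have "end_transport (a us) e = e" if "walk (parcs G) g us g" "even (length us)" for us
    using commuting_fixes_end[OF _ _ e(1) fix_b[OF vs(1,2)], of "a us"] walk_b[OF vs(1,2)] vs(3)
      walk_a[OF that] commute[OF that vs(1,2)] e(2) by simp
  with that[OF e(1,2)] fix_b show thesis
    by (simp add: a_def b_def)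
qed

lemma exists_fixed_end:
  assumes nontriv: "\<not> left_trivial G H f" "\<not> left_trivial H G (f \<circ> prod.swap)"
    and arcs: "(g, g') \<in> parcs G" "(h, h') \<in> parcs H"
  obtains e where "reduced_end (parcs K) e" "shd e = f (g, h)"
    "\<And>W. walk (parcs GH) (g, h) W (g, h) \<Longrightarrow> end_transport (map f W) e = e"
proof -
  obtain e where e: "reduced_end (parcs K) e" "shd e = f (g, h)"
    and fix_row: "\<And>us. walk (parcs G) g us g \<Longrightarrow> even (length us) \<Longrightarrow>
      end_transport (map f (row us h h')) e = e"
    and fix_column: "\<And>vs. walk (parcs H) h vs h \<Longrightarrow> even (length vs) \<Longrightarrow>
      end_transport (map f (column vs g g')) e = e"
    using exists_end_fixed_by_rows_and_columns[OF nontriv arcs] by blast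
  have "end_transport (map f W) e = e" if W: "walk (parcs GH) (g, h) W (g, h)" for W
  proof (rule square_fixes_end[OF _ e(1)])
    show "walk (parcs K) (shd e) (map f W) (shd e)"
      using walk_hom[OF W] e(2) by simp
    obtain us vs where uv: "walk (parcs G) g us g" "even (length us)"
        "walk (parcs H) h vs h" "even (length vs)"
      and eq: "\<And>p. reduced (parcs K) p \<Longrightarrow> hd p = f (g, h) \<Longrightarrow>
        transport (map f (W @ W)) p = transport (map f (row us h h' @ column vs g g')) p"
      using square_eq_row_column[OF W arcs] by blast
    have "end_transport (map f (W @ W)) e = end_transport (map f (row us h h' @ column vs g g')) e"
      using eq e(2) by (intro end_transport_cong[OF e(1)]) simp
    then show "end_transport (map f W @ map f W) e = e"
      using fix_row[OF uv(1,2)] fix_column[OF uv(3,4)] by simp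
  qed
  with that e show thesis by blast
qed

lemma exists_end_coloring:
  assumes "\<not> left_trivial G H f" "\<not> left_trivial H G (f \<circ> prod.swap)"
  shows "\<exists>\<epsilon>. (\<forall>v\<in>pverts GH. reduced_end (parcs K) (\<epsilon> v) \<and> shd (\<epsilon> v) = f v) \<and>
    (\<forall>(u, v)\<in>parcs GH. \<epsilon> v = end_step (f v) (\<epsilon> u))"
proof -
  obtain g g' h h' where arcs: "(g, g') \<in> parcs G" "(h, h') \<in> parcs H"
    using proper_graph_nonempty[OF proper_G] proper_graph_nonempty[OF proper_H] neighbour_G
      neighbour_H by blast
  obtain e where e: "reduced_end (parcs K) e" "shd e = f (g, h)"
    "\<And>W. walk (parcs GH) (g, h) W (g, h) \<Longrightarrow> end_transport (map f W) e = e"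
    using exists_fixed_end[OF assms arcs] by blast
  have "(g, h) \<in> pverts GH"
    using arcs subset_G subset_H by auto
  from fixed_end_extends[OF proper_graph_sym[OF proper_GH] connected_GH[OF this]
      proper_graph_subset[OF proper_GH] graph_hom_arcD[OF hom] e]
  show ?thesis .
qed

end

section \<open>Recoloring\<close>

definition recolors :: "'a pair_pre_digraph \<Rightarrow> 'b pair_pre_digraph \<Rightarrow> ('a \<Rightarrow> 'b) \<Rightarrow> ('a \<Rightarrow> 'b) \<Rightarrow> bool"
  where
  "recolors G K f f' \<longleftrightarrow> graph_hom G K f \<and> graph_hom G K f' \<and> card {v \<in> pverts G. f v \<noteq> f' v} \<le> 1"

lemma recoloring_reachable_iff_rtranclp:
  "recoloring_reachable G K f f' \<longleftrightarrow> graph_hom G K f \<and> (recolors G K)\<^sup>*\<^sup>* f f'"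
proof
  assume "recoloring_reachable G K f f'"
  then obtain m :: nat and s where s: "s 0 = f" "s m = f'" "\<forall>i\<le>m. graph_hom G K (s i)"
      "\<forall>i<m. card {v \<in> pverts G. s i v \<noteq> s (Suc i) v} \<le> 1"
    unfolding recoloring_reachable_def by blast
  then have "\<forall>i<m. recolors G K (s i) (s (Suc i))"
    by (simp add: recolors_def)
  then have "(recolors G K ^^ m) f f'"
    using s(1,2) by (auto simp: relpowp_fun_conv)
  then show "graph_hom G K f \<and> (recolors G K)\<^sup>*\<^sup>* f f'"
    using s(1,3) by (auto dest: relpowp_imp_rtranclp)
next
  assume "graph_hom G K f \<and> (recolors G K)\<^sup>*\<^sup>* f f'"
  then obtain m where "graph_hom G K f" "(recolors G K ^^ m) f f'"
    by (auto dest: rtranclp_imp_relpowp)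
  then obtain s where s: "graph_hom G K (s 0)" "s 0 = f" "s m = f'"
      "\<forall>i<m. recolors G K (s i) (s (Suc i))"
    by (auto simp: relpowp_fun_conv)
  then have "graph_hom G K (s i)" if "i \<le> m" for i
    using that by (cases i) (auto simp: recolors_def)
  with s show "recoloring_reachable G K f f'"
    unfolding recoloring_reachable_def recolors_def by blast
qed

lemma recoloring_reachable_refl: "graph_hom G K f \<Longrightarrow> recoloring_reachable G K f f"
  by (simp add: recoloring_reachable_iff_rtranclp)

lemma recoloring_reachable_trans:
  "recoloring_reachable G K f f' \<Longrightarrow> recoloring_reachable G K f' f'' \<Longrightarrow> recoloring_reachable G K f f''"
  by (auto simp: recoloring_reachable_iff_rtranclp)

lemma recoloring_reachable_hom: "recoloring_reachable G K f f' \<Longrightarrow> graph_hom G K f'"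
  unfolding recoloring_reachable_def by blast

lemma recoloring_reachable_if_eq_except:
  assumes "graph_hom G K f" "graph_hom G K f'" "\<And>u. u \<in> pverts G \<Longrightarrow> u \<noteq> v \<Longrightarrow> f u = f' u"
  shows "recoloring_reachable G K f f'"
proof -
  have "{u \<in> pverts G. f u \<noteq> f' u} \<subseteq> {v}"
    using assms(3) by auto
  then have "card {u \<in> pverts G. f u \<noteq> f' u} \<le> card {v}"
    by (rule card_mono[rotated]) simp
  then have "recolors G K f f'"
    using assms(1,2) by (simp add: recolors_def)
  then show ?thesis
    using assms(1) by (auto simp: recoloring_reachable_iff_rtranclp)
qed

lemma recoloring_reachable_comp:
  assumes "recoloring_reachable G' K f f'" "graph_hom G G' \<phi>" "inj_on \<phi> (pverts G)"
      "finite (pverts G')"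
  shows "recoloring_reachable G K (f \<circ> \<phi>) (f' \<circ> \<phi>)"
proof -
  have step: "recolors G K (g \<circ> \<phi>) (g' \<circ> \<phi>)" if "recolors G' K g g'" for g g'
  proof -
    have "card {v \<in> pverts G. (g \<circ> \<phi>) v \<noteq> (g' \<circ> \<phi>) v} \<le> card {v \<in> pverts G'. g v \<noteq> g' v}"
      using assms(2-4) by (intro card_inj_on_le[of \<phi>]) (auto simp: graph_hom_def inj_on_def)
    with that show ?thesis
      unfolding recolors_def by (auto intro: graph_hom_comp[OF assms(2)])
  qed
  have "(recolors G' K)\<^sup>*\<^sup>* f f'" "graph_hom G' K f"
    using assms(1) by (simp_all add: recoloring_reachable_iff_rtranclp)
  from this(1) have "(recolors G K)\<^sup>*\<^sup>* (f \<circ> \<phi>) (f' \<circ> \<phi>)"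
    by (induction rule: rtranclp_induct) (blast intro: rtranclp.rtrancl_into_rtrancl step)+
  with \<open>graph_hom G' K f\<close> show ?thesis
    by (simp add: recoloring_reachable_iff_rtranclp graph_hom_comp[OF assms(2)])
qed

lemma recoloring_reachable_swap:
  assumes "proper_graph G" "proper_graph H"
    and "recoloring_reachable (tensor_product H G) K (f \<circ> prod.swap) f'"
  shows "recoloring_reachable (tensor_product G H) K f (f' \<circ> prod.swap)"
  using recoloring_reachable_comp[OF assms(3) graph_hom_swap inj_on_subset[OF inj_swap subset_UNIV]]
    proper_graph_finite[OF assms(1)] proper_graph_finite[OF assms(2)] by (simp add: comp_assoc)

lemma recoloring_reachable_if_independent:
  assumes "proper_graph G" and "graph_hom G K f" "graph_hom G K f'"
    and "\<And>u v. (u, v) \<in> parcs G \<Longrightarrow> f u = f' u \<or> f v = f' v"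
  shows "recoloring_reachable G K f f'"
  using assms(2-)
proof (induction "card {v \<in> pverts G. f v \<noteq> f' v}" arbitrary: f rule: less_induct)
  case less
  show ?case
  proof (cases "\<exists>w\<in>pverts G. f w \<noteq> f' w")
    case False
    with less.prems show ?thesis
      by (intro recoloring_reachable_if_eq_except) auto
  next
    case True
    then obtain w where w: "w \<in> pverts G" "f w \<noteq> f' w" by blast
    define g where "g = f(w := f' w)"
    have hom: "graph_hom G K g"
      unfolding graph_hom_def
    proof (intro conjI ballI, safe)
      fix v assume "v \<in> pverts G"
      then show "g v \<in> pverts K"
        using less.prems(1,2) by (auto simp: g_def graph_hom_def)
    next
      fix u v assume "(u, v) \<in> parcs G"
      then have "f u = f' u \<or> f v = f' v" "(f u, f v) \<in> parcs K" "(f' u, f' v) \<in> parcs K"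
        using less.prems by (auto simp: graph_hom_def)
      then show "(g u, g v) \<in> parcs K"
        using w by (auto simp: g_def)
    qed
    have "{v \<in> pverts G. g v \<noteq> f' v} \<subset> {v \<in> pverts G. f v \<noteq> f' v}"
      using w by (auto simp: g_def)
    then have "card {v \<in> pverts G. g v \<noteq> f' v} < card {v \<in> pverts G. f v \<noteq> f' v}"
      using proper_graph_finite[OF assms(1)] by (intro psubset_card_mono) auto
    moreover have "g u = f' u \<or> g v = f' v" if "(u, v) \<in> parcs G" for u v
      using less.prems(3)[OF that] by (auto simp: g_def)
    ultimately have "recoloring_reachable G K g f'"
      using less.hyps hom less.prems(2) by blast
    moreover have "recoloring_reachable G K f g"
      using less.prems(1) hom by (rule recoloring_reachable_if_eq_except[of _ _ _ _ w])
        (simp add: g_def)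
    ultimately show ?thesis
      by (rule recoloring_reachable_trans[rotated])
  qed
qed

section \<open>Contracting the layers\<close>

text \<open>
  \<open>D h g w\<close> is the geodesic in the universal cover, a tree, from the lift of \<open>(g, h)\<close> to the
  lift of \<open>(w, h)\<close>.
\<close>

locale layer_lift = tensor_coloring G H K f
  for G :: "'a pair_pre_digraph" and H :: "'b pair_pre_digraph" and K :: "'c pair_pre_digraph"
      and f +
  fixes D :: "'b \<Rightarrow> 'a \<Rightarrow> 'a \<Rightarrow> 'c list"
  assumes lift_refl: "g \<in> pverts G \<Longrightarrow> h \<in> pverts H \<Longrightarrow> D h g g = [f (g, h)]"
    and lift_arc: "(h, h') \<in> parcs H \<Longrightarrow> (g, g') \<in> parcs G \<Longrightarrow> (w, w') \<in> parcs G \<Longrightarrow>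
      D h' g' w' = lstep (f (g', h')) (rstep (D h g w) (f (w', h')))"
    and reduced_lift: "g \<in> pverts G \<Longrightarrow> w \<in> pverts G \<Longrightarrow> h \<in> pverts H \<Longrightarrow> reduced (parcs K) (D h g w)"
begin

lemma
  assumes "g \<in> pverts G" "w \<in> pverts G" "h \<in> pverts H"
  shows hd_lift: "hd (D h g w) = f (g, h)" and last_lift: "last (D h g w) = f (w, h)"
proof -
  obtain h' g' w' where "(h', h) \<in> parcs H" "(g', g) \<in> parcs G" "(w', w) \<in> parcs G"
    using neighbour_G neighbour_H symD[OF sym_G] symD[OF sym_H] assms by metis
  from lift_arc[OF this] show "hd (D h g w) = f (g, h)" "last (D h g w) = f (w, h)"
    by (simp_all add: last_lstep)
qed

lemma lift_two_arcs:
  assumes "(w, v) \<in> parcs G" "(v, g) \<in> parcs G" "(h, h') \<in> parcs H" "u \<in> pverts G"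
  shows "D h g u = lstep (f (g, h)) (lstep (f (v, h')) (D h w u))"
proof -
  obtain u' where u': "(u, u') \<in> parcs G"
    using neighbour_G assms(4) by blast
  have V: "w \<in> pverts G" "h \<in> pverts H"
    using assms subset_G subset_H by auto
  have "D h g u = lstep (f (g, h)) (rstep (D h' v u') (f (u, h)))"
    using lift_arc[OF symD[OF sym_H assms(3)] assms(2) symD[OF sym_G u']] .
  also have "D h' v u' = lstep (f (v, h')) (rstep (D h w u) (f (u', h')))"
    using lift_arc[OF assms(3,1) u'] .
  also have "rstep \<dots> (f (u, h)) = lstep (f (v, h')) (D h w u)"
    using rstep_rstep_last[OF reduced_lift[OF V(1) assms(4) V(2)]] last_lift[OF V(1) assms(4) V(2)]
    by (simp add: rstep_lstep)
  finally show ?thesis .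
qed

lemma lift_transport:
  assumes "walk (parcs G) w us g" "even (length us)" "(h, h') \<in> parcs H" "u \<in> pverts G"
  shows "D h g u = transport (map f (row us h h')) (D h w u)"
  using assms(1,2)
proof (induction us arbitrary: w rule: induct_list012)
  case (3 v v' us)
  then have "D h g u = transport (map f (row us h h')) (D h v' u)"
    by simp
  then show ?case
    using lift_two_arcs[OF _ _ assms(3,4), of w v v'] 3(3) by simp
qed simp_all

lemma lift_eq_transport:
  assumes "walk (parcs G) w us g" "even (length us)" "(h, h') \<in> parcs H" "w \<in> pverts G"
  shows "D h g w = transport (map f (row us h h')) [f (w, h)]"
  using lift_transport[OF assms] lift_refl[OF assms(4)] assms(3) subset_H by auto

lemma lift_triangle:
  assumes V: "g \<in> pverts G" "w \<in> pverts G" "u \<in> pverts G" "h \<in> pverts H"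
  shows "D h g u = prolong (D h g w) (tl (D h w u))"
proof -
  obtain us where us: "even (length us)" "walk (parcs G) w us g"
    using even_walk_G[OF V(2,1)] .
  obtain h' where h': "(h, h') \<in> parcs H"
    using neighbour_H V(4) by blast
  show ?thesis
    using lift_transport[OF us(2,1) h' V(3)] lift_eq_transport[OF us(2,1) h' V(2)]
      transport_from_hd[OF reduced_lift[OF V(2,3,4)]] hd_lift[OF V(2,3,4)] by simp
qed

lemma odd_length_lift:
  assumes V: "g \<in> pverts G" "w \<in> pverts G" "h \<in> pverts H"
  shows "odd (length (D h g w))"
proof -
  obtain us where us: "even (length us)" "walk (parcs G) w us g"
    using even_walk_G[OF V(2,1)] .
  obtain h' where h': "(h, h') \<in> parcs H"
    using neighbour_H V(3) by blast
  show ?thesis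
    using lift_eq_transport[OF us(2,1) h' V(2)] us(1) by (simp add: even_length_transport)
qed

lemma lift_sym:
  assumes V: "g \<in> pverts G" "w \<in> pverts G" "h \<in> pverts H"
  shows "D h w g = rev (D h g w)"
proof (rule prolong_eq_hdD[OF reduced_lift reduced_lift])
  show "prolong (D h g w) (tl (D h w g)) = [hd (D h g w)]"
    using lift_triangle[OF V(1,2,1,3)] lift_refl[OF V(1,3)] hd_lift[OF V] by simp
  show "hd (D h w g) = last (D h g w)"
    using hd_lift last_lift V by simp
qed (use V in auto)

end

context square_free_tensor_coloring
begin

lemma transport_row_unique:
  assumes triv: "left_trivial G H f" and w: "w \<in> pverts G"
    and us: "walk (parcs G) w us g" "even (length us)" "(h, h1) \<in> parcs H"
    and us': "walk (parcs G) w us' g" "even (length us')" "(h, h2) \<in> parcs H"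
  shows "transport (map f (row us h h1)) [f (w, h)] = transport (map f (row us' h h2)) [f (w, h)]"
proof -
  let ?x = "f (w, h)" and ?W = "map f (row us h h2)" and ?W' = "map f (row us' h h2)"
  let ?R = "rev_walk ?x ?W'"
  have "transport (map f (row (us @ rev_walk w us') h h2)) [?x] = [?x]"
    using w us us' walk_rev_walk[OF sym_G us'(1)]
    by (intro left_trivialD[OF triv]) (auto intro: walk_appendI)
  then have "transport ?R (transport ?W [?x]) = [?x]"
    using us(2) us'(2) by (simp add: row_append rev_walk_row flip: map_rev_walk)
  also have "\<dots> = transport ?R (transport ?W' [?x])"
    using transport_back[of "[?x]" ?W' "f (g, h)"] walk_hom_row[OF us'] by simp
  finally have "transport ?R (transport ?W [?x]) = transport ?R (transport ?W' [?x])" .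
  moreover have "walk (parcs K) ?x ?W (f (g, h))" "walk (parcs K) ?x ?W' (f (g, h))"
    using walk_hom_row[OF us(1,2) us'(3)] walk_hom_row[OF us'] .
  then have "reduced (parcs K) (transport ?W [?x])" "hd (transport ?W [?x]) = f (g, h)"
      "reduced (parcs K) (transport ?W' [?x])" "hd (transport ?W' [?x]) = f (g, h)"
      "walk (parcs K) (f (g, h)) ?R ?x"
    using reduced_transport[of "[?x]"] hd_transport[of "[?x]"] walk_rev_walk[OF sym_E] by simp_all
  ultimately have "transport ?W [?x] = transport ?W' [?x]"
    using transport_inj by metis
  moreover have "transport (map f (row us h h1)) [?x] = transport ?W [?x]"
    by (rule transport_homotopic[OF homotopic_row_change_neighbour[OF sym_H us us'(3)]]) simp_all
  ultimately show ?thesis by simp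
qed

lemma left_trivial_transportE:
  assumes triv: "left_trivial G H f"
  obtains D where "\<And>h h' g w us. walk (parcs G) w us g \<Longrightarrow> even (length us) \<Longrightarrow> (h, h') \<in> parcs H \<Longrightarrow>
    w \<in> pverts G \<Longrightarrow> D h g w = transport (map f (row us h h')) [f (w, h)]"
proof -
  have "\<exists>us. even (length us) \<and> walk (parcs G) w us g" if "w \<in> pverts G" "g \<in> pverts G" for w g
    using even_walk_G[OF that] by blast
  then obtain U where U: "even (length (U w g))" "walk (parcs G) w (U w g) g"
    if "w \<in> pverts G" "g \<in> pverts G" for w g
    by metis
  obtain n where n: "(h, n h) \<in> parcs H" if "h \<in> pverts H" for h
    using neighbour_H by metis
  have "transport (map f (row (U w g) h (n h))) [f (w, h)] =
      transport (map f (row us h h')) [f (w, h)]"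
    if "walk (parcs G) w us g" "even (length us)" "(h, h') \<in> parcs H" "w \<in> pverts G" for h h' g w us
  proof -
    have "g \<in> pverts G" "h \<in> pverts H"
      using that walk_in_vertices[OF that(1) subset_G] subset_H by auto
    then show ?thesis
      using transport_row_unique[OF triv that(4) U(2,1) n that(1-3)] that(4) by simp
  qed
  then show thesis
    by (rule that)
qed

lemma exists_layer_lift:
  assumes "left_trivial G H f"
  shows "\<exists>D. layer_lift G H K f D"
proof -
  obtain D where D: "\<And>h h' g w us. walk (parcs G) w us g \<Longrightarrow> even (length us) \<Longrightarrow> (h, h') \<in> parcs H \<Longrightarrow>
      w \<in> pverts G \<Longrightarrow> D h g w = transport (map f (row us h h')) [f (w, h)]"
    using left_trivial_transportE[OF assms] by blast
  have "layer_lift G H K f D"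
  proof unfold_locales
    fix g h assume "g \<in> pverts G" "h \<in> pverts H"
    then show "D h g g = [f (g, h)]"
      using D[of g "[]" g h] neighbour_H by fastforce
  next
    fix g w h assume V: "g \<in> pverts G" "w \<in> pverts G" "h \<in> pverts H"
    obtain us where us: "even (length us)" "walk (parcs G) w us g"
      using even_walk_G[OF V(2,1)] .
    obtain h' where h': "(h, h') \<in> parcs H"
      using neighbour_H V(3) by blast
    show "reduced (parcs K) (D h g w)"
      using reduced_transport[of "[f (w, h)]"] walk_hom_row[OF us(2,1) h'] D[OF us(2,1) h' V(2)]
      by simp
  next
    fix h h' g g' w w'
    assume arcs: "(h, h') \<in> parcs H" "(g, g') \<in> parcs G" "(w, w') \<in> parcs G"
    then have V: "g \<in> pverts G" "w \<in> pverts G" "w' \<in> pverts G"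
      using subset_G by auto
    obtain us where us: "even (length us)" "walk (parcs G) w us g"
      using even_walk_G[OF V(2,1)] .
    let ?W = "map f (row us h h')"
    have "walk (parcs G) w' (w # us @ [g']) g'"
      using us(2) arcs symD[OF sym_G] by (auto intro: walk_appendI)
    then have "D h' g' w' = transport (map f (row (w # us @ [g']) h' h)) [f (w', h')]"
      using us(1) arcs(1) V(3) by (intro D) (auto dest: symD[OF sym_H])
    also have "\<dots> = lstep (f (g', h')) (transport ?W (prolong [f (w, h)] [f (w', h')]))"
      using us(1) by (simp add: row_Cons_snoc)
    also have "transport ?W (prolong [f (w, h)] [f (w', h')]) = rstep (D h g w) (f (w', h'))"
      using D[OF us(2,1) arcs(1) V(2)] by (simp only: transport_prolong) simp
    finally show "D h' g' w' = lstep (f (g', h')) (rstep (D h g w) (f (w', h')))" .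
  qed
  then show ?thesis
    by blast
qed

end

definition spread :: "'a pair_pre_digraph \<Rightarrow> 'b pair_pre_digraph \<Rightarrow> ('b \<Rightarrow> 'a \<Rightarrow> 'a \<Rightarrow> 'c list) \<Rightarrow> nat"
  where
  "spread G H D = (\<Sum>(h, g, w)\<in>pverts H \<times> pverts G \<times> pverts G. length (D h g w))"

text \<open>
  The peak consists of the vertices of layer \<open>h0\<close> with a common lift at maximal distance from
  that of \<open>(a, h0)\<close>. If all their neighbours lie one step further inwards, in \<open>x1\<close>, then the
  peak can be moved two steps inwards, to \<open>x2\<close>.
\<close>

locale retractable_peak = layer_lift G H K f D
  for G :: "'a pair_pre_digraph" and H :: "'b pair_pre_digraph" and K :: "'c pair_pre_digraph"
      and f D +
  fixes h0 :: 'b and a :: 'a and x0 x1 x2 :: 'c and xs :: "'c list"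
  assumes h0: "h0 \<in> pverts H" and a: "a \<in> pverts G"
    and farthest: "h \<in> pverts H \<Longrightarrow> g \<in> pverts G \<Longrightarrow> w \<in> pverts G \<Longrightarrow>
      length (D h g w) \<le> length (x0 # x1 # x2 # xs)"
    and attained: "\<exists>g\<in>pverts G. D h0 g a = x0 # x1 # x2 # xs"
    and inwards: "D h0 g a = x0 # x1 # x2 # xs \<Longrightarrow> (g, g') \<in> parcs G \<Longrightarrow> (h0, h') \<in> parcs H \<Longrightarrow>
      f (g', h') = x1"
begin

definition peak :: "('a \<times> 'b) set" where
  "peak = {g \<in> pverts G. D h0 g a = x0 # x1 # x2 # xs} \<times> {h0}"

definition recolored :: "'a \<times> 'b \<Rightarrow> 'c" where
  "recolored v = (if v \<in> peak then x2 else f v)"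

definition lmove :: "'a \<times> 'b \<Rightarrow> 'c list \<Rightarrow> 'c list" where
  "lmove v p = (if v \<in> peak then lstep x2 (lstep x1 p) else p)"

definition rmove :: "'a \<times> 'b \<Rightarrow> 'c list \<Rightarrow> 'c list" where
  "rmove v p = rev (lmove v (rev p))"

definition moved_lift :: "'b \<Rightarrow> 'a \<Rightarrow> 'a \<Rightarrow> 'c list" where
  "moved_lift h g w = rmove (w, h) (lmove (g, h) (D h g w))"

lemma color_peak: "v \<in> peak \<Longrightarrow> f v = x0"
  using hd_lift[OF _ a h0, of "fst v"] by (auto simp: peak_def)

lemma arcs_x: "(x0, x1) \<in> parcs K" "(x1, x2) \<in> parcs K"
proof -
  obtain g where "g \<in> pverts G" "D h0 g a = x0 # x1 # x2 # xs"
    using attained by blast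
  then show "(x0, x1) \<in> parcs K" "(x1, x2) \<in> parcs K"
    using reduced_lift[OF _ a h0, of g] by auto
qed

lemma color_neighbour_of_peak: "u \<in> peak \<Longrightarrow> (u, v) \<in> parcs GH \<Longrightarrow> v \<notin> peak \<and> f v = x1"
  using inwards[of "fst u" "fst v" "snd v"] proper_graph_irrefl[OF proper_H]
  by (cases u; cases v) (auto simp: peak_def)

lemma recolored_eq_or: "(u, v) \<in> parcs GH \<Longrightarrow> f u = recolored u \<or> f v = recolored v"
  using color_neighbour_of_peak[of u v] by (auto simp: recolored_def)

lemma hom_recolored: "graph_hom GH K recolored"
proof (rule graph_hom_if_arcs[OF proper_GH proper_K])
  fix u v assume uv: "(u, v) \<in> parcs GH"
  show "(recolored u, recolored v) \<in> parcs K"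
    using color_neighbour_of_peak[OF _ uv]
      color_neighbour_of_peak[OF _ symD[OF proper_graph_sym[OF proper_GH] uv]]
      graph_hom_arcD[OF hom uv] arcs_x(2) symD[OF sym_E arcs_x(2)]
    by (auto simp: recolored_def)
qed

lemma last_lmove: "p \<noteq> [] \<Longrightarrow> last (lmove v p) = last p"
  by (simp add: lmove_def last_lstep)

lemma reduced_lmove: "reduced (parcs K) p \<Longrightarrow> hd p = f v \<Longrightarrow> reduced (parcs K) (lmove v p)"
  using color_peak[of v] arcs_x by (auto simp: lmove_def intro!: reduced_lstep)

lemma reduced_rmove: "reduced (parcs K) p \<Longrightarrow> last p = f v \<Longrightarrow> reduced (parcs K) (rmove v p)"
  unfolding rmove_def reduced_rev by (rule reduced_lmove) (auto simp: reduced_rev hd_rev)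

lemma lmove_rstep: "lmove v (rstep p k) = rstep (lmove v p) k"
  by (simp add: lmove_def rstep_lstep)

lemma rmove_lstep: "rmove v (lstep k p) = lstep k (rmove v p)"
  using lmove_rstep[of v "rev p" k] by (simp add: rmove_def rstep_def)

lemma lmove_lstep:
  assumes uv: "(u, v) \<in> parcs GH" and p: "reduced (parcs K) p" "hd p = f u"
  shows "lmove v (lstep (f v) p) = lstep (recolored v) (lmove u p)"
proof -
  consider "u \<in> peak" | "v \<in> peak" | "u \<notin> peak" "v \<notin> peak"
    by blast
  then show ?thesis
  proof cases
    case 1
    then have v: "v \<notin> peak" "f v = x1"
      using color_neighbour_of_peak[OF 1 uv] by auto
    have "reduced (parcs K) (lstep x1 p)"
      using p color_peak[OF 1] arcs_x(1) by (intro reduced_lstep) simp_all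
    from lstep_lstep_hd[OF this, of x2] show ?thesis
      using 1 v by (simp add: lmove_def recolored_def)
  next
    case 2
    then have u: "u \<notin> peak" "f u = x1"
      using color_neighbour_of_peak[OF 2 symD[OF proper_graph_sym[OF proper_GH] uv]] by auto
    then show ?thesis
      using 2 lstep_lstep_hd[OF p(1), of x0] p(2) color_peak[OF 2]
      by (simp add: lmove_def recolored_def)
  qed (simp add: lmove_def recolored_def)
qed

lemma rmove_rstep:
  assumes "(u, v) \<in> parcs GH" "reduced (parcs K) p" "last p = f u"
  shows "rmove v (rstep p (f v)) = rstep (rmove u p) (recolored v)"
  using lmove_lstep[OF assms(1), of "rev p"] assms(2,3)
  by (simp add: rmove_def rstep_def reduced_rev hd_rev reduced_not_Nil)

lemma moved_lift_eq_recolored: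
  assumes "D h g w = [f (g, h)]" "(g, h) \<in> peak \<longleftrightarrow> (w, h) \<in> peak"
  shows "moved_lift h g w = [recolored (g, h)]"
  using assms irrefl_E arcs_x color_peak
  by (auto simp: moved_lift_def rmove_def lmove_def recolored_def)

lemma moved_lift_arc:
  assumes arcs: "(h, h') \<in> parcs H" "(g, g') \<in> parcs G" "(w, w') \<in> parcs G"
  shows "moved_lift h' g' w' =
    lstep (recolored (g', h')) (rstep (moved_lift h g w) (recolored (w', h')))"
proof -
  have V: "g \<in> pverts G" "w \<in> pverts G" "h \<in> pverts H"
    using arcs subset_G subset_H by auto
  let ?p = "D h g w" and ?v = "(g', h')" and ?w = "(w', h')"
  have p: "reduced (parcs K) ?p" "hd ?p = f (g, h)" "last ?p = f (w, h)"
    using reduced_lift hd_lift last_lift V by simp_all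
  have uv: "((g, h), ?v) \<in> parcs GH" "((w, h), ?w) \<in> parcs GH"
    using arcs by simp_all
  have "reduced (parcs K) (rstep ?p (f ?w))" "hd (rstep ?p (f ?w)) = f (g, h)"
    using p graph_hom_arcD[OF hom uv(2)] by (auto simp: reduced_rstep hd_rstep)
  then have "moved_lift h' g' w' =
      rmove ?w (lstep (recolored ?v) (lmove (g, h) (rstep ?p (f ?w))))"
    unfolding moved_lift_def lift_arc[OF arcs] using lmove_lstep[OF uv(1)] by simp
  also have "\<dots> = lstep (recolored ?v) (rmove ?w (rstep (lmove (g, h) ?p) (f ?w)))"
    by (simp only: lmove_rstep rmove_lstep)
  also have "rmove ?w (rstep (lmove (g, h) ?p) (f ?w)) = rstep (moved_lift h g w) (recolored ?w)"
    unfolding moved_lift_def using p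
    by (intro rmove_rstep[OF uv(2)] reduced_lmove) (auto simp: last_lmove)
  finally show ?thesis .
qed

lemma layer_lift_moved_lift: "layer_lift G H K recolored moved_lift"
proof unfold_locales
  show "graph_hom GH K recolored"
    by (rule hom_recolored)
  show "moved_lift h g g = [recolored (g, h)]" if "g \<in> pverts G" "h \<in> pverts H" for g h
    using moved_lift_eq_recolored lift_refl[OF that] by blast
  show "reduced (parcs K) (moved_lift h g w)"
    if V: "g \<in> pverts G" "w \<in> pverts G" "h \<in> pverts H" for g w h
    unfolding moved_lift_def using reduced_lift[OF V] hd_lift[OF V] last_lift[OF V]
    by (intro reduced_rmove reduced_lmove) (auto simp: last_lmove)
  show "moved_lift h' g' w' =
      lstep (recolored (g', h')) (rstep (moved_lift h g w) (recolored (w', h')))"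
    if "(h, h') \<in> parcs H" "(g, g') \<in> parcs G" "(w, w') \<in> parcs G" for h h' g g' w w'
    using that by (rule moved_lift_arc)
qed (rule proper_G proper_H proper_K parity_connected_G parity_connected_H)+

lemma lift_from_peak_not_singleton:
  assumes g: "(g, h0) \<in> peak" and w: "w \<in> pverts G" "(w, h0) \<notin> peak"
  shows "tl (D h0 g w) \<noteq> []"
proof
  assume single: "tl (D h0 g w) = []"
  have gV: "g \<in> pverts G" and ga: "D h0 g a = x0 # x1 # x2 # xs"
    using g by (auto simp: peak_def)
  have "D h0 g w = [hd (D h0 w a)]"
    using single reduced_lift[OF gV w(1) h0] last_lift[OF gV w(1) h0] hd_lift[OF w(1) a h0]
    by (cases "D h0 g w") auto
  then have "D h0 g a = D h0 w a"
    using lift_triangle[OF gV w(1) a h0] prolong_hd_tl[OF reduced_lift[OF w(1) a h0]] by simp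
  then show False
    using w ga by (simp add: peak_def)
qed

lemma lift_from_peak:
  assumes g: "(g, h0) \<in> peak" and w: "w \<in> pverts G" "(w, h0) \<notin> peak"
  shows "\<exists>r. D h0 g w = x0 # x1 # r"
proof -
  have gV: "g \<in> pverts G" and ga: "D h0 g a = x0 # x1 # x2 # xs"
    using g by (auto simp: peak_def)
  obtain y r where yr: "D h0 g w = x0 # y # r"
    using reduced_lift[OF gV w(1) h0] hd_lift[OF gV w(1) h0] color_peak[OF g]
      lift_from_peak_not_singleton[OF assms]
    by (cases "D h0 g w"; cases "tl (D h0 g w)") auto
  moreover have "y = x1"
  proof (rule ccontr)
    assume y: "y \<noteq> x1"
    have "reduced (parcs K) (rev (y # r) @ [x0])"
      using reduced_lift[OF gV w(1) h0] yr reduced_rev[of "D h0 g w"] by simp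
    moreover have "reduced (parcs K) (x0 # x1 # x2 # xs)"
      using reduced_lift[OF gV a h0] ga by simp
    ultimately have "reduced (parcs K) (rev (D h0 g w) @ x1 # x2 # xs)"
      using y yr reduced_append_Cons_iff[of "parcs K" "rev (y # r)" x0 "x1 # x2 # xs"] by simp
    then have "prolong (rev (D h0 g w)) (x1 # x2 # xs) = rev (D h0 g w) @ x1 # x2 # xs"
      using yr by (intro prolong_eq_append) auto
    then have "length (D h0 w a) = length (D h0 g w) + length (x1 # x2 # xs)"
      using lift_triangle[OF w(1) gV a h0] lift_sym[OF gV w(1) h0] ga by simp
    then show False
      using farthest[OF h0 w(1) a] yr by simp
  qed
  ultimately show ?thesis by blast
qed

lemma length_moved_lift_from_peak:
  assumes "(g, h0) \<in> peak" "w \<in> pverts G" "(w, h0) \<notin> peak"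
  shows "length (moved_lift h0 g w) \<le> length (D h0 g w)"
proof -
  obtain r where r: "D h0 g w = x0 # x1 # r"
    using lift_from_peak[OF assms] by blast
  have "moved_lift h0 g w = lstep x2 (x1 # r)"
    using assms(1,3) r by (simp add: moved_lift_def rmove_def lmove_def)
  then show ?thesis
    using length_lstep_le[of x2 "x1 # r"] r by simp
qed

lemma lift_within_peak:
  assumes "(g, h) \<in> peak" "(w, h) \<in> peak"
  shows "D h g w = [f (g, h)]"
proof -
  have V: "g \<in> pverts G" "w \<in> pverts G" and h: "h = h0" and eq: "D h0 g a = D h0 w a"
    using assms by (auto simp: peak_def)
  have "D h0 g w = prolong (D h0 g a) (tl (rev (D h0 g a)))"
    using lift_triangle[OF V(1) a V(2) h0] lift_sym[OF V(2) a h0] eq by simp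
  also have "\<dots> = [f (g, h0)]"
    using prolong_tl_rev[OF reduced_not_Nil[OF reduced_lift[OF V(1) a h0]]] hd_lift[OF V(1) a h0]
    by simp
  finally show ?thesis
    using h by simp
qed

lemma length_moved_lift_le:
  assumes V: "h \<in> pverts H" "g \<in> pverts G" "w \<in> pverts G"
  shows "length (moved_lift h g w) \<le> length (D h g w)"
proof -
  interpret moved: layer_lift G H K recolored moved_lift
    by (rule layer_lift_moved_lift)
  consider "(g, h) \<notin> peak" "(w, h) \<notin> peak" | "(g, h) \<in> peak" "(w, h) \<notin> peak"
    | "(g, h) \<notin> peak" "(w, h) \<in> peak" | "(g, h) \<in> peak" "(w, h) \<in> peak"
    by blast
  then show ?thesis
  proof cases
    case 1
    then show ?thesis by (simp add: moved_lift_def rmove_def lmove_def)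
  next
    case 2
    then show ?thesis
      using length_moved_lift_from_peak[of g w] V by (auto simp: peak_def)
  next
    case 3
    then have "length (moved_lift h w g) \<le> length (D h w g)"
      using length_moved_lift_from_peak[of w g] V by (auto simp: peak_def)
    then show ?thesis
      using lift_sym[OF V(2,3,1)] moved.lift_sym[OF V(2,3,1)] by simp
  next
    case 4
    then show ?thesis
      using moved_lift_eq_recolored[OF lift_within_peak[OF 4]] lift_within_peak[OF 4] by simp
  qed
qed

lemma spread_moved_lift: "spread G H moved_lift < spread G H D"
  unfolding spread_def
proof (rule sum_strict_mono_ex1)
  show "finite (pverts H \<times> pverts G \<times> pverts G)"
    using proper_graph_finite[OF proper_G] proper_graph_finite[OF proper_H] by simp
  show "\<forall>t\<in>pverts H \<times> pverts G \<times> pverts G. (case t of (h, g, w) \<Rightarrow> length (moved_lift h g w))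
      \<le> (case t of (h, g, w) \<Rightarrow> length (D h g w))"
    using length_moved_lift_le by auto
  obtain g where g: "g \<in> pverts G" "D h0 g a = x0 # x1 # x2 # xs"
    using attained by blast
  then have "(g, h0) \<in> peak" "(a, h0) \<notin> peak"
    using lift_refl[OF a h0] by (auto simp: peak_def)
  then have "moved_lift h0 g a = x2 # xs"
    using g by (simp add: moved_lift_def rmove_def lmove_def)
  then show "\<exists>t\<in>pverts H \<times> pverts G \<times> pverts G. (case t of (h, g, w) \<Rightarrow> length (moved_lift h g w))
      < (case t of (h, g, w) \<Rightarrow> length (D h g w))"
    using g h0 a by (intro bexI[of _ "(h0, g, a)"]) auto
qed

end

context layer_lift
begin

lemma lift_outwards:
  assumes "D h g b = x" "3 \<le> length x" "(h, h') \<in> parcs H" "(g, g') \<in> parcs G" "(b, c) \<in> parcs G"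
    and "f (g', h') \<noteq> x ! 1" "length (D h' g' c) \<le> length x"
  shows "D h' g' c = f (g', h') # butlast x"
proof -
  have outwards: "lstep (f (g', h')) p = f (g', h') # p" if "2 \<le> length p" "p ! 1 = x ! 1" for p
    using that assms(6) by (cases p rule: remdups_adj.cases) auto
  have eq: "D h' g' c = lstep (f (g', h')) (rstep x (f (c, h')))"
    using lift_arc[OF assms(3,4,5)] assms(1) by simp
  consider "rstep x (f (c, h')) = x @ [f (c, h')]" | "rstep x (f (c, h')) = butlast x"
    using rstep_cases[of x] by blast
  then show ?thesis
  proof cases
    case 1
    then have "length (D h' g' c) = length x + 2"
      using eq outwards[of "x @ [f (c, h')]"] assms(2) by (simp add: nth_append)
    then show ?thesis
      using assms(7) by simp
  next
    case 2
    then show ?thesis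
      using eq outwards[of "butlast x"] assms(2) by (simp add: nth_butlast)
  qed
qed

text \<open>
  If every farthest point of every layer had a neighbour that is not further inwards, then the
  opposite ends of these points would form larger and larger spheres, and finally whole layers.
\<close>

lemma lift_constant_on_spheres:
  assumes far: "\<And>h g w. h \<in> pverts H \<Longrightarrow> g \<in> pverts G \<Longrightarrow> w \<in> pverts G \<Longrightarrow> length (D h g w) \<le> M"
    and M: "3 \<le> M"
    and stuck: "\<And>h g a. h \<in> pverts H \<Longrightarrow> g \<in> pverts G \<Longrightarrow> a \<in> pverts G \<Longrightarrow> length (D h g a) = M \<Longrightarrow>
      \<exists>g1 g' h'. D h g1 a = D h g a \<and> (g1, g') \<in> parcs G \<and> (h, h') \<in> parcs H \<and>
          f (g', h') \<noteq> D h g a ! 1"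
    and V: "h0 \<in> pverts H" "g0 \<in> pverts G" "a0 \<in> pverts G" and attained: "length (D h0 g0 a0) = M"
  shows "\<exists>h\<in>pverts H. \<exists>g\<in>pverts G. \<exists>x. length x = M \<and>
    (\<forall>us b. length us = n \<and> walk (parcs G) a0 us b \<longrightarrow> D h g b = x)"
proof (induction n)
  case 0
  then show ?case
    using V attained by (intro bexI[of _ h0] bexI[of _ g0]) auto
next
  case (Suc n)
  then obtain h g x where hg: "h \<in> pverts H" "g \<in> pverts G" and x: "length x = M"
    and sphere: "\<And>us b. length us = n \<Longrightarrow> walk (parcs G) a0 us b \<Longrightarrow> D h g b = x"
    by blast
  obtain z where z: "(a0, z) \<in> parcs G"
    using neighbour_G V(3) by blast
  obtain us a where us: "length us = n" "walk (parcs G) a0 us a"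
    using walk_alternate[OF sym_G z, of n] length_alternate[of n z a0] by blast
  have a: "a \<in> pverts G"
    using walk_in_vertices[OF us(2) subset_G V(3)] .
  obtain g1 g' h' where g1: "D h g1 a = x" and arcs: "(g1, g') \<in> parcs G" "(h, h') \<in> parcs H"
    and out: "f (g', h') \<noteq> x ! 1"
    using stuck[OF hg a] sphere[OF us] x by auto
  have V': "g1 \<in> pverts G" "g' \<in> pverts G" "h' \<in> pverts H"
    using arcs subset_G subset_H by auto
  have "D h' g' c = f (g', h') # butlast x"
    if vs: "length vs = Suc n" "walk (parcs G) a0 vs c" for vs c
  proof -
    obtain vs' b where b: "length vs' = n" "walk (parcs G) a0 vs' b" "(b, c) \<in> parcs G"
      using vs by (cases vs rule: rev_cases) (auto simp: walk_append)
    then have bV: "b \<in> pverts G" "c \<in> pverts G"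
      using subset_G by auto
    have "D h g1 b = D h g b"
      using lift_triangle[OF V'(1) a bV(1) hg(1)] lift_triangle[OF hg(2) a bV(1) hg(1)] g1
        sphere[OF us]
      by simp
    then show ?thesis
      using lift_outwards[OF _ _ arcs(2,1) b(3) out] sphere[OF b(1,2)] far[OF V'(3,2) bV(2)] x M
      by simp
  qed
  moreover have "length (f (g', h') # butlast x) = M"
    using x M by simp
  ultimately show ?case
    using V'(2,3) by blast
qed

lemma exists_inward_peak:
  assumes far: "\<And>h g w. h \<in> pverts H \<Longrightarrow> g \<in> pverts G \<Longrightarrow> w \<in> pverts G \<Longrightarrow> length (D h g w) \<le> M"
    and M: "3 \<le> M"
    and V: "h0 \<in> pverts H" "g0 \<in> pverts G" "a0 \<in> pverts G" and attained: "length (D h0 g0 a0) = M"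
  obtains h g a where "h \<in> pverts H" "g \<in> pverts G" "a \<in> pverts G" "length (D h g a) = M"
    "\<And>g1 g' h'. D h g1 a = D h g a \<Longrightarrow> (g1, g') \<in> parcs G \<Longrightarrow> (h, h') \<in> parcs H \<Longrightarrow>
      f (g', h') = D h g a ! 1"
proof (rule ccontr)
  assume "\<not> thesis"
  with that have stuck: "\<exists>g1 g' h'. D h g1 a = D h g a \<and> (g1, g') \<in> parcs G \<and> (h, h') \<in> parcs H \<and>
      f (g', h') \<noteq> D h g a ! 1"
    if farthest: "h \<in> pverts H" "g \<in> pverts G" "a \<in> pverts G" "length (D h g a) = M" for h g a
    using farthest by blast
  obtain n where n: "\<forall>b\<in>pverts G. \<exists>us. length us = n \<and> walk (parcs G) a0 us b"
    using parity_connected_equal_length_walks[OF proper_G parity_connected_G V(3)] by blast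
  obtain h g x where hg: "h \<in> pverts H" "g \<in> pverts G" and x: "length x = M"
    and sphere: "\<And>us b. length us = n \<Longrightarrow> walk (parcs G) a0 us b \<Longrightarrow> D h g b = x"
    using lift_constant_on_spheres[OF far M stuck V attained, of n] by blast
  have "D h g g = x"
    using n sphere hg(2) by blast
  then show False
    using lift_refl[OF hg(2,1)] x M by auto
qed

lemma exists_smaller_layer_lift:
  assumes V: "h \<in> pverts H" "g \<in> pverts G" "w \<in> pverts G" and nonconst: "length (D h g w) \<noteq> 1"
  obtains f' D' where "layer_lift G H K f' D'" "recoloring_reachable GH K f f'"
      "spread G H D' < spread G H D"
proof -
  let ?T = "pverts H \<times> pverts G \<times> pverts G" and ?l = "\<lambda>(h, g, w). length (D h g w)"
  define M where "M = Max (?l ` ?T)"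
  have fin: "finite ?T"
    using proper_graph_finite[OF proper_G] proper_graph_finite[OF proper_H] by simp
  then have far: "length (D h g w) \<le> M" if "h \<in> pverts H" "g \<in> pverts G" "w \<in> pverts G" for h g w
    unfolding M_def using that by (intro Max_ge) (auto intro!: image_eqI[of _ _ "(h, g, w)"])
  have "M \<in> ?l ` ?T"
    unfolding M_def using fin V by (intro Max_in) auto
  then obtain h0 g0 a0 where att: "h0 \<in> pverts H" "g0 \<in> pverts G" "a0 \<in> pverts G"
      "length (D h0 g0 a0) = M"
    by auto
  have "length (D h g w) \<noteq> 0" "length (D h g w) \<noteq> 2"
    using odd_length_lift[OF V(2,3,1)] by (auto simp del: length_0_conv)
  then have M: "3 \<le> M"
    using far[OF V] nonconst by linarith
  obtain h g a where hga: "h \<in> pverts H" "g \<in> pverts G" "a \<in> pverts G" "length (D h g a) = M"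
    and inwards: "\<And>g1 g' h'. D h g1 a = D h g a \<Longrightarrow> (g1, g') \<in> parcs G \<Longrightarrow> (h, h') \<in> parcs H \<Longrightarrow>
      f (g', h') = D h g a ! 1"
    by (rule exists_inward_peak[OF far M att]) auto
  obtain x0 x1 x2 xs where x: "D h g a = x0 # x1 # x2 # xs"
    using hga(4) M by (cases "D h g a"; cases "tl (D h g a)"; cases "tl (tl (D h g a))") auto
  interpret retractable_peak G H K f D h a x0 x1 x2 xs
    by unfold_locales (use hga x far inwards in auto)
  have "recoloring_reachable GH K f recolored"
    using recoloring_reachable_if_independent[OF proper_GH hom hom_recolored]
      recolored_eq_or by blast
  then show thesis
    using that layer_lift_moved_lift spread_moved_lift by blast
qed

end

lemma layer_lift_recolors_to_factor:
  assumes "layer_lift G H K f D"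
  shows "\<exists>f'. recoloring_reachable (tensor_product G H) K f f' \<and>
    factors_through (tensor_product G H) H K f'"
  using assms
proof (induction "spread G H D" arbitrary: f D rule: less_induct)
  case less
  interpret layer_lift G H K f D
    by (rule less.prems)
  show ?case
  proof (cases "\<exists>h\<in>pverts H. \<exists>g\<in>pverts G. \<exists>w\<in>pverts G. length (D h g w) \<noteq> 1")
    case True
    then obtain f' D' where "layer_lift G H K f' D'" "recoloring_reachable GH K f f'"
        "spread G H D' < spread G H D"
      using exists_smaller_layer_lift by blast
    then show ?thesis
      using less.hyps[of D' f'] recoloring_reachable_trans by blast
  next
    case False
    have "f (g, h) = f (w, h)" if V: "g \<in> pverts G" "w \<in> pverts G" "h \<in> pverts H" for g w h
    proof -
      have "length (D h g w) = 1"
        using False V by blast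
      then show ?thesis
        using hd_lift[OF V] last_lift[OF V] by (cases "D h g w") auto
    qed
    then have "factors_through GH H K f"
      by (intro factors_through_snd proper_G proper_H proper_K hom)
    then show ?thesis
      using recoloring_reachable_refl[OF hom] by blast
  qed
qed

context square_free_tensor_coloring
begin

lemma left_trivial_recolors_to_factor:
  assumes "left_trivial G H f"
  shows "\<exists>f'. recoloring_reachable GH K f f' \<and> factors_through GH H K f'"
  using exists_layer_lift[OF assms] layer_lift_recolors_to_factor by blast

lemma right_trivial_recolors_to_factor:
  assumes "left_trivial H G (f \<circ> prod.swap)"
  shows "\<exists>f'. recoloring_reachable GH K f f' \<and> factors_through GH G K f'"
proof -
  interpret swap: square_free_tensor_coloring H G K "f \<circ> prod.swap"
    by (rule square_free_tensor_coloring_swap)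
  show ?thesis
    using swap.left_trivial_recolors_to_factor[OF assms]
      recoloring_reachable_swap[OF proper_G proper_H] factors_through_comp[OF _ graph_hom_swap]
    by blast
qed

end

section \<open>Recoloring towards a cycle\<close>

definition periodic :: "'c stream \<Rightarrow> bool" where
  "periodic s \<longleftrightarrow> (\<exists>n>0. sdrop n s = s)"

definition period :: "'c stream \<Rightarrow> nat" where
  "period s = (LEAST n. 0 < n \<and> sdrop n s = s)"

definition eventually_periodic :: "'c stream \<Rightarrow> bool" where
  "eventually_periodic s \<longleftrightarrow> (\<exists>i. periodic (sdrop i s))"

definition preperiod :: "'c stream \<Rightarrow> nat" where
  "preperiod s = (LEAST i. periodic (sdrop i s))"

lemma periodic_stl: "periodic s \<Longrightarrow> periodic (stl s)"
  unfolding periodic_def by (metis sdrop_stl)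

lemma eventually_periodic_stl_iff [simp]: "eventually_periodic (stl s) \<longleftrightarrow> eventually_periodic s"
proof
  assume "eventually_periodic (stl s)"
  then obtain i where "periodic (sdrop (Suc i) s)"
    by (auto simp: eventually_periodic_def)
  then show "eventually_periodic s"
    unfolding eventually_periodic_def by blast
next
  assume "eventually_periodic s"
  then show "eventually_periodic (stl s)"
    unfolding eventually_periodic_def by (metis sdrop_stl periodic_stl)
qed

lemma periodic_if_preperiod_eq_0: "eventually_periodic s \<Longrightarrow> preperiod s = 0 \<Longrightarrow> periodic s"
  unfolding eventually_periodic_def preperiod_def
  by (metis (mono_tags, lifting) LeastI_ex sdrop.simps(1))

lemma preperiod_stl:
  assumes "eventually_periodic s"
  shows "preperiod (stl s) = preperiod s - 1"
proof -
  have periodic: "periodic (sdrop (preperiod s) s)"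
    using assms unfolding eventually_periodic_def preperiod_def by (rule LeastI_ex)
  have least: "preperiod s \<le> i" if "periodic (sdrop i s)" for i
    unfolding preperiod_def using that by (rule Least_le)
  show ?thesis
    unfolding preperiod_def[of "stl s"]
  proof (rule Least_equality)
    show "periodic (sdrop (preperiod s - 1) (stl s))"
      using periodic periodic_stl[OF periodic] by (cases "preperiod s") auto
    show "preperiod s - 1 \<le> i" if "periodic (sdrop i (stl s))" for i
      using least[of "Suc i"] that by simp
  qed
qed

lemma sdrop_mult: "sdrop n s = s \<Longrightarrow> sdrop (k * n) s = s"
proof (induction k)
  case (Suc k)
  then show ?case
    using sdrop_add[of "k * n" n s] by simp
qed simp

lemma sdrop_mod: "sdrop n s = s \<Longrightarrow> sdrop (i mod n) s = sdrop i s"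
  using sdrop_add[of "i mod n" "i div n * n" s] sdrop_mult[of n s "i div n"] by simp

lemma periodic_sdrop_returns:
  assumes "periodic s"
  shows "\<exists>k. sdrop k (sdrop i s) = s"
proof -
  obtain n where "0 < n" "sdrop n s = s"
    using assms by (auto simp: periodic_def)
  then have "sdrop (i * n - i) (sdrop i s) = s"
    using sdrop_mult[of n s i] by simp
  then show ?thesis ..
qed

lemma eventually_periodic_if_sdrop_eq:
  assumes "i \<noteq> j" "sdrop i s = sdrop j s"
  shows "eventually_periodic s"
  using assms
proof (induction i j rule: linorder_wlog)
  case (le i j)
  have "sdrop (j - i) (sdrop i s) = sdrop j s"
    using le(1) by simp
  then have "sdrop (j - i) (sdrop i s) = sdrop i s"
    using le(3) by metis
  then show ?case
    using le unfolding eventually_periodic_def periodic_def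
    by (metis le_neq_implies_less zero_less_diff)
qed metis

lemma
  assumes "periodic s"
  shows period_pos: "0 < period s" and sdrop_period: "sdrop (period s) s = s"
proof -
  have "\<exists>n. 0 < n \<and> sdrop n s = s"
    using assms by (simp add: periodic_def)
  then have "0 < period s \<and> sdrop (period s) s = s"
    unfolding period_def by (rule LeastI_ex)
  then show "0 < period s" "sdrop (period s) s = s"
    by simp_all
qed

lemma period_le: "0 < n \<Longrightarrow> sdrop n s = s \<Longrightarrow> period s \<le> n"
  unfolding period_def by (simp add: Least_le)

lemma sdrop_inj_below_period:
  assumes "periodic s" "i < period s" "j < period s" "sdrop i s = sdrop j s"
  shows "i = j"
  using assms(2-4)
proof (induction i j rule: linorder_wlog)
  case (le i j)
  let ?n = "period s"
  have "sdrop (i + (?n - j)) s = sdrop (?n - j) (sdrop i s)"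
    by (simp only: sdrop_add)
  also have "\<dots> = sdrop (?n - j) (sdrop j s)"
    using le(4) by simp
  also have "\<dots> = s"
    using le(3) sdrop_period[OF assms(1)] by simp
  finally have "sdrop (i + (?n - j)) s = s" .
  then have "?n \<le> i + (?n - j)"
    using le by (intro period_le) simp_all
  then show ?case
    using le by linarith
qed simp

text \<open>
  Joining each stream to its tail gives a functional graph, in which everything can be pushed
  towards the cycles, that is, towards the periodic streams.
\<close>

definition tail_coloring :: "'v pair_pre_digraph \<Rightarrow> 'c pair_pre_digraph \<Rightarrow> ('v \<Rightarrow> 'c stream) \<Rightarrow> bool"
  where
  "tail_coloring P K \<epsilon> \<longleftrightarrow> (\<forall>v\<in>pverts P. \<forall>i. (\<epsilon> v !! i, \<epsilon> v !! Suc i) \<in> parcs K) \<and>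
     (\<forall>(u, v)\<in>parcs P. \<epsilon> v = stl (\<epsilon> u) \<or> \<epsilon> u = stl (\<epsilon> v))"

lemma tail_coloring_stl: "tail_coloring P K \<epsilon> \<Longrightarrow> (u, v) \<in> parcs P \<Longrightarrow>
    \<epsilon> v = stl (\<epsilon> u) \<or> \<epsilon> u = stl (\<epsilon> v)"
  by (auto simp: tail_coloring_def)

lemma tail_coloring_arc: "tail_coloring P K \<epsilon> \<Longrightarrow> v \<in> pverts P \<Longrightarrow> (\<epsilon> v !! i, \<epsilon> v !! Suc i) \<in> parcs K"
  by (auto simp: tail_coloring_def)

lemma tail_coloring_hom:
  assumes \<epsilon>: "tail_coloring P K \<epsilon>" and P: "proper_graph P" and K: "proper_graph K"
  shows "graph_hom P K (shd \<circ> \<epsilon>)"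
proof (rule graph_hom_if_arcs[OF P K])
  fix u v assume uv: "(u, v) \<in> parcs P"
  then have "(\<epsilon> u !! 0, \<epsilon> u !! 1) \<in> parcs K" "(\<epsilon> v !! 0, \<epsilon> v !! 1) \<in> parcs K"
    using tail_coloring_arc[OF \<epsilon>, of _ 0] proper_graph_subset[OF P] by auto
  then show "((shd \<circ> \<epsilon>) u, (shd \<circ> \<epsilon>) v) \<in> parcs K"
    using tail_coloring_stl[OF \<epsilon> uv] symD[OF proper_graph_sym[OF K]] by auto
qed

lemma tail_coloring_walk:
  assumes \<epsilon>: "tail_coloring P K \<epsilon>" and "walk (parcs P) v W u"
  shows "\<exists>i j. sdrop i (\<epsilon> v) = sdrop j (\<epsilon> u) \<and> even (i + j) = even (length W)"
  using assms(2)
proof (induction W arbitrary: v)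
  case Nil
  then show ?case by (intro exI[of _ 0]) simp
next
  case (Cons w W)
  then have "walk (parcs P) w W u"
    by simp
  from Cons.IH[OF this] obtain i j
    where ij: "sdrop i (\<epsilon> w) = sdrop j (\<epsilon> u)" "even (i + j) = even (length W)"
    by blast
  have "\<epsilon> w = stl (\<epsilon> v) \<or> \<epsilon> v = stl (\<epsilon> w)"
    using tail_coloring_stl[OF \<epsilon>] Cons.prems by simp
  moreover have "sdrop i (stl (\<epsilon> w)) = sdrop j (stl (\<epsilon> u))"
    by (simp only: sdrop_stl ij(1))
  ultimately have "sdrop (Suc i) (\<epsilon> v) = sdrop j (\<epsilon> u) \<or> sdrop i (\<epsilon> v) = sdrop (Suc j) (\<epsilon> u)"
    using ij(1) by auto
  moreover have "even (Suc i + j) = even (length (w # W))"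
      "even (i + Suc j) = even (length (w # W))"
    using ij(2) by simp_all
  ultimately show ?case by blast
qed

lemma tail_coloring_eventually_periodic:
  assumes "tail_coloring P K \<epsilon>" "parity_connected P" "v \<in> pverts P"
  shows "eventually_periodic (\<epsilon> v)"
proof -
  obtain W where "even (length W) = False" "walk (parcs P) v W v"
    using parity_connectedE[OF assms(2,3,3)] .
  then obtain i j where "sdrop i (\<epsilon> v) = sdrop j (\<epsilon> v)" "odd (i + j)"
    using tail_coloring_walk[OF assms(1), of v W v] by auto
  moreover from this(2) have "i \<noteq> j"
    by auto
  ultimately show ?thesis
    using eventually_periodic_if_sdrop_eq by blast
qed

lemma tail_coloring_push:
  assumes \<epsilon>: "tail_coloring P K \<epsilon>" and P: "proper_graph P"
    and ev: "\<And>v. v \<in> pverts P \<Longrightarrow> eventually_periodic (\<epsilon> v)"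
    and v: "v \<in> pverts P" "0 < preperiod (\<epsilon> v)"
        "\<And>u. u \<in> pverts P \<Longrightarrow> preperiod (\<epsilon> u) \<le> preperiod (\<epsilon> v)"
  shows "tail_coloring P K (\<epsilon>(v := stl (stl (\<epsilon> v))))"
  unfolding tail_coloring_def
proof (intro conjI ballI allI, goal_cases)
  case (1 u i)
  then show ?case
    using tail_coloring_arc[OF \<epsilon> v(1), of "Suc (Suc i)"] tail_coloring_arc[OF \<epsilon> 1, of i] by simp
next
  case (2 xy)
  have neighbour: "\<epsilon> u = stl (\<epsilon> v)" if "(u, v) \<in> parcs P" for u
  proof (rule ccontr)
    assume "\<epsilon> u \<noteq> stl (\<epsilon> v)"
    then have "\<epsilon> v = stl (\<epsilon> u)"
      using tail_coloring_stl[OF \<epsilon> that] by simp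
    moreover have "u \<in> pverts P"
      using that proper_graph_subset[OF P] by auto
    ultimately have "preperiod (\<epsilon> v) = preperiod (\<epsilon> u) - 1" "preperiod (\<epsilon> u) \<le> preperiod (\<epsilon> v)"
      using preperiod_stl[OF ev] v(3) by simp_all
    then show False
      using v(2) by linarith
  qed
  obtain x y where xy: "xy = (x, y)" "(x, y) \<in> parcs P"
    using 2 by (cases xy) auto
  then have yx: "(y, x) \<in> parcs P"
    using symD[OF proper_graph_sym[OF P]] by blast
  consider "x = v" "y \<noteq> v" | "x \<noteq> v" "y = v" | "x \<noteq> v" "y \<noteq> v"
    using xy(2) proper_graph_irrefl[OF P, of v] by blast
  then show ?case
    using neighbour[of x] neighbour[of y] tail_coloring_stl[OF \<epsilon> xy(2)] xy yx by cases auto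
qed

lemma exists_smaller_tail_coloring:
  assumes P: "proper_graph P" and K: "proper_graph K" and \<epsilon>: "tail_coloring P K \<epsilon>"
    and ev: "\<And>v. v \<in> pverts P \<Longrightarrow> eventually_periodic (\<epsilon> v)"
    and u: "u \<in> pverts P" "\<not> periodic (\<epsilon> u)"
  obtains \<epsilon>' where "tail_coloring P K \<epsilon>'" "\<And>v. v \<in> pverts P \<Longrightarrow> eventually_periodic (\<epsilon>' v)"
    "recoloring_reachable P K (shd \<circ> \<epsilon>) (shd \<circ> \<epsilon>')"
    "(\<Sum>v\<in>pverts P. preperiod (\<epsilon>' v)) < (\<Sum>v\<in>pverts P. preperiod (\<epsilon> v))"
proof -
  let ?preperiods = "(\<lambda>v. preperiod (\<epsilon> v)) ` pverts P"
  have fin: "finite ?preperiods" "?preperiods \<noteq> {}"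
    using proper_graph_finite[OF P] proper_graph_nonempty[OF P] by simp_all
  then obtain v where v: "v \<in> pverts P" "Max ?preperiods = preperiod (\<epsilon> v)"
    using Max_in by auto
  have max: "preperiod (\<epsilon> w) \<le> preperiod (\<epsilon> v)" if "w \<in> pverts P" for w
    using Max_ge[OF fin(1)] that by (simp flip: v(2))
  have pos: "0 < preperiod (\<epsilon> v)"
    using u max[OF u(1)] ev[OF u(1)] periodic_if_preperiod_eq_0 by (metis le_zero_eq neq0_conv)
  define \<epsilon>' where "\<epsilon>' = \<epsilon>(v := stl (stl (\<epsilon> v)))"
  have \<epsilon>': "tail_coloring P K \<epsilon>'"
    unfolding \<epsilon>'_def by (rule tail_coloring_push[OF \<epsilon> P ev v(1) pos max])
  have "preperiod (\<epsilon>' v) < preperiod (\<epsilon> v)"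
    using pos ev[OF v(1)] by (simp add: \<epsilon>'_def preperiod_stl)
  then have "(\<Sum>v\<in>pverts P. preperiod (\<epsilon>' v)) < (\<Sum>v\<in>pverts P. preperiod (\<epsilon> v))"
    using proper_graph_finite[OF P] v(1) by (intro sum_strict_mono_ex1) (auto simp: \<epsilon>'_def)
  moreover have "eventually_periodic (\<epsilon>' w)" if "w \<in> pverts P" for w
    using ev that v(1) by (simp add: \<epsilon>'_def)
  moreover have "recoloring_reachable P K (shd \<circ> \<epsilon>) (shd \<circ> \<epsilon>')"
    using tail_coloring_hom[OF \<epsilon> P K] tail_coloring_hom[OF \<epsilon>' P K]
    by (rule recoloring_reachable_if_eq_except[of _ _ _ _ v]) (simp add: \<epsilon>'_def)
  ultimately show thesis
    using that \<epsilon>' by blast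
qed

lemma tail_coloring_recolors_to_periodic:
  assumes P: "proper_graph P" and K: "proper_graph K"
    and "tail_coloring P K \<epsilon>" "\<And>v. v \<in> pverts P \<Longrightarrow> eventually_periodic (\<epsilon> v)"
  shows "\<exists>\<epsilon>'. tail_coloring P K \<epsilon>' \<and> recoloring_reachable P K (shd \<circ> \<epsilon>) (shd \<circ> \<epsilon>') \<and>
    (\<forall>v\<in>pverts P. periodic (\<epsilon>' v))"
  using assms(3,4)
proof (induction "\<Sum>v\<in>pverts P. preperiod (\<epsilon> v)" arbitrary: \<epsilon> rule: less_induct)
  case less
  show ?case
  proof (cases "\<forall>v\<in>pverts P. periodic (\<epsilon> v)")
    case True
    then show ?thesis
      using less.prems(1) recoloring_reachable_refl[OF tail_coloring_hom[OF less.prems(1) P K]]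
      by blast
  next
    case False
    then obtain v where "v \<in> pverts P" "\<not> periodic (\<epsilon> v)"
      by blast
    from exists_smaller_tail_coloring[OF P K less.prems this] obtain \<epsilon>'
      where "tail_coloring P K \<epsilon>'" "\<And>v. v \<in> pverts P \<Longrightarrow> eventually_periodic (\<epsilon>' v)"
        "recoloring_reachable P K (shd \<circ> \<epsilon>) (shd \<circ> \<epsilon>')"
        "(\<Sum>v\<in>pverts P. preperiod (\<epsilon>' v)) < (\<Sum>v\<in>pverts P. preperiod (\<epsilon> v))"
      by blast
    then show ?thesis
      using less.hyps[of \<epsilon>'] recoloring_reachable_trans by blast
  qed
qed

lemma graph_hom_cycle_graph:
  assumes K: "proper_graph K" and s: "sdrop n s = s" "\<And>i. (s !! i, s !! Suc i) \<in> parcs K"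
  shows "graph_hom (cycle_graph n) K (snth s)"
proof -
  have "s !! (Suc i mod n) = s !! Suc i" for i
    using sdrop_mod[OF s(1), of "Suc i"] by (metis sdrop_simps(1))
  then show ?thesis
    using s(2) symD[OF proper_graph_sym[OF K] s(2)] proper_graph_subset[OF K]
    by (auto simp: graph_hom_def cycle_graph_def)
qed

lemma periodic_tail_coloring_orbit:
  assumes \<epsilon>: "tail_coloring P K \<epsilon>" and "parity_connected P"
    and periodic: "\<And>v. v \<in> pverts P \<Longrightarrow> periodic (\<epsilon> v)" and V: "u \<in> pverts P" "v \<in> pverts P"
  shows "\<exists>i<period (\<epsilon> u). \<epsilon> v = sdrop i (\<epsilon> u)"
proof -
  obtain W where "walk (parcs P) v W u"
    using parity_connectedE[OF assms(2) V(2,1)] .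
  then obtain i j where "sdrop i (\<epsilon> v) = sdrop j (\<epsilon> u)"
    using tail_coloring_walk[OF \<epsilon>] by blast
  moreover obtain k where "sdrop k (sdrop i (\<epsilon> v)) = \<epsilon> v"
    using periodic_sdrop_returns[OF periodic[OF V(2)]] by blast
  ultimately have "\<epsilon> v = sdrop ((j + k) mod period (\<epsilon> u)) (\<epsilon> u)"
    using sdrop_mod[OF sdrop_period[OF periodic[OF V(1)]]] by simp
  then show ?thesis
    using period_pos[OF periodic[OF V(1)]] by (intro exI[of _ "(j + k) mod period (\<epsilon> u)"]) simp
qed

lemma tail_coloring_hom_to_cycle_graph:
  assumes \<epsilon>: "tail_coloring P K \<epsilon>" and P: "proper_graph P" and s: "periodic s"
    and c: "\<And>v. v \<in> pverts P \<Longrightarrow> c v < period s \<and> \<epsilon> v = sdrop (c v) s"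
  shows "graph_hom P (cycle_graph (period s)) c"
  unfolding graph_hom_def
proof (intro conjI ballI, safe)
  show "c v \<in> pverts (cycle_graph (period s))" if "v \<in> pverts P" for v
    using c[OF that] by (simp add: cycle_graph_def)
next
  fix u v assume uv: "(u, v) \<in> parcs P"
  have successor: "c w' = Suc (c w) mod period s"
    if "\<epsilon> w' = stl (\<epsilon> w)" "w \<in> pverts P" "w' \<in> pverts P" for w w'
    using sdrop_inj_below_period[OF s, of "c w'" "Suc (c w) mod period s"] period_pos[OF s]
      sdrop_mod[OF sdrop_period[OF s], of "Suc (c w)"] c[OF that(2)] c[OF that(3)] that(1) by simp
  have V: "u \<in> pverts P" "v \<in> pverts P"
    using uv proper_graph_subset[OF P] by auto
  then have "c v = Suc (c u) mod period s \<or> c u = Suc (c v) mod period s"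
    using tail_coloring_stl[OF \<epsilon> uv] successor by blast
  then show "(c u, c v) \<in> parcs (cycle_graph (period s))"
    using c[OF V(1)] c[OF V(2)] by (auto simp: cycle_graph_def)
qed

lemma periodic_tail_coloring_factors_through_cycle:
  assumes P: "proper_graph P" "parity_connected P" and K: "proper_graph K"
    and \<epsilon>: "tail_coloring P K \<epsilon>" and periodic: "\<And>v. v \<in> pverts P \<Longrightarrow> periodic (\<epsilon> v)"
  shows "\<exists>n. proper_graph (cycle_graph n) \<and> factors_through P (cycle_graph n) K (shd \<circ> \<epsilon>)"
proof -
  obtain u where u: "u \<in> pverts P"
    using proper_graph_nonempty[OF P(1)] by blast
  define s where "s = \<epsilon> u"
  have s: "periodic s" "\<And>i. (s !! i, s !! Suc i) \<in> parcs K"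
    using periodic[OF u] tail_coloring_arc[OF \<epsilon> u] by (simp_all add: s_def)
  have "\<exists>i. i < period s \<and> \<epsilon> v = sdrop i s" if "v \<in> pverts P" for v
    using periodic_tail_coloring_orbit[OF \<epsilon> P(2) periodic u that] by (simp add: s_def)
  then obtain c where c: "\<And>v. v \<in> pverts P \<Longrightarrow> c v < period s \<and> \<epsilon> v = sdrop (c v) s"
    by metis
  then have "(shd \<circ> \<epsilon>) v = (snth s \<circ> c) v" if "v \<in> pverts P" for v
    using that by simp
  then have "factors_through P (cycle_graph (period s)) K (shd \<circ> \<epsilon>)"
    unfolding factors_through_def
    using tail_coloring_hom_to_cycle_graph[OF \<epsilon> P(1) s(1) c]
      graph_hom_cycle_graph[OF K sdrop_period[OF s(1)] s(2)]
    by blast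
  moreover have "period s \<noteq> 1"
  proof
    assume "period s = 1"
    then have "stl s = s"
      using sdrop_period[OF s(1)] by simp
    then show False
      using s(2)[of 0] proper_graph_irrefl[OF K] by simp
  qed
  then have "proper_graph (cycle_graph (period s))"
    using period_pos[OF s(1)] by (simp add: proper_graph_cycle_graph)
  ultimately show ?thesis by blast
qed

lemma tail_coloring_recolors_to_cycle:
  assumes P: "proper_graph P" "parity_connected P" and K: "proper_graph K"
      and \<epsilon>: "tail_coloring P K \<epsilon>"
  shows "\<exists>f' n. recoloring_reachable P K (shd \<circ> \<epsilon>) f' \<and> proper_graph (cycle_graph n) \<and>
    factors_through P (cycle_graph n) K f'"
  using tail_coloring_recolors_to_periodic[OF P(1) K \<epsilon> tail_coloring_eventually_periodic[OF \<epsilon> P(2)]]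
    periodic_tail_coloring_factors_through_cycle[OF P K] by blast

lemma (in square_free_tensor_coloring) nontrivial_recolors_to_cycle:
  assumes "\<not> left_trivial G H f" "\<not> left_trivial H G (f \<circ> prod.swap)"
  shows "\<exists>f' n. recoloring_reachable GH K f f' \<and> proper_graph (cycle_graph n) \<and>
    factors_through GH (cycle_graph n) K f'"
proof -
  obtain \<epsilon> where \<epsilon>: "\<And>v. v \<in> pverts GH \<Longrightarrow> reduced_end (parcs K) (\<epsilon> v) \<and> shd (\<epsilon> v) = f v"
    and arc: "\<And>u v. (u, v) \<in> parcs GH \<Longrightarrow> \<epsilon> v = end_step (f v) (\<epsilon> u)"
    using exists_end_coloring[OF assms] by blast
  have "\<epsilon> v = stl (\<epsilon> u) \<or> \<epsilon> u = stl (\<epsilon> v)" if "(u, v) \<in> parcs GH" for u v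
    using end_step_eq_tail[of "f v" "\<epsilon> u"] arc[OF that] by auto
  then have "tail_coloring GH K \<epsilon>"
    unfolding tail_coloring_def using \<epsilon> reduced_end_arc by blast
  moreover from this have "recoloring_reachable GH K f (shd \<circ> \<epsilon>)"
    using \<epsilon>
    by (intro recoloring_reachable_if_eq_except[OF hom] tail_coloring_hom proper_GH proper_K) auto
  ultimately show ?thesis
    using tail_coloring_recolors_to_cycle[OF proper_GH parity_connected_GH proper_K]
      recoloring_reachable_trans
    by blast
qed

section \<open>Factorization after recoloring\<close>

theorem theorem20:
  fixes G :: "'a pair_pre_digraph" and H :: "'b pair_pre_digraph"
    and K :: "'c pair_pre_digraph" and \<mu> :: "'a \<times> 'b \<Rightarrow> 'c"
  assumes "proper_graph G" and "proper_graph H" and "proper_graph K"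
    and "square_free K"
    and "Digraph_Component.connected (with_proj G)" and "\<not> bipartite G"
    and "Digraph_Component.connected (with_proj H)" and "\<not> bipartite H"
    and "graph_hom (tensor_product G H) K \<mu>"
  shows "\<exists>\<mu>'. graph_hom (tensor_product G H) K \<mu>' \<and>
           recoloring_reachable (tensor_product G H) K \<mu> \<mu>' \<and>
           (factors_through (tensor_product G H) G K \<mu>' \<or>
            factors_through (tensor_product G H) H K \<mu>' \<or>
            (\<exists>n. proper_graph (cycle_graph n) \<and>
                 factors_through (tensor_product G H) (cycle_graph n) K \<mu>'))"
proof -
  interpret square_free_tensor_coloring G H K \<mu>
    by unfold_locales (use assms parity_connected_if_nonbipartite in blast)+
  consider "left_trivial G H \<mu>" | "left_trivial H G (\<mu> \<circ> prod.swap)"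
    | "\<not> left_trivial G H \<mu>" "\<not> left_trivial H G (\<mu> \<circ> prod.swap)"
    by blast
  then show ?thesis
  proof cases
    case 1
    from left_trivial_recolors_to_factor[OF this] show ?thesis
      using recoloring_reachable_hom by blast
  next
    case 2
    from right_trivial_recolors_to_factor[OF this] show ?thesis
      using recoloring_reachable_hom by blast
  next
    case 3
    from nontrivial_recolors_to_cycle[OF this] show ?thesis
      using recoloring_reachable_hom by blast
  qed
qed

end
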